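(* For all integers $n\ge 3$, $d\ge 0$ and $2\le j\le n-1$, $$b_{n,d}(1,j)+b_{n,d}(j,1)=2\,p_{n,d}(1,j).$$
   Context: $\mathcal S_n$ is the set of permutations of $[n]=\{1,\dots,n\}$. For a word $\pi=\pi_1\cdots\pi_n$ with distinct letters, $\mathrm{des}(\pi)$ is the number of $i\in[n-1]$ with $\pi_i>\pi_{i+1}$ (descents) and $\mathrm{asc}(\pi)$ is the number of $i\in[n-1]$ with $\pi_i<\pi_{i+1}$ (ascents). The height is $h(\pi)=\mathrm{asc}(\pi)-\mathrm{des}(\pi)$. A permutation $\pi$ is a ballot permutation if $h(\pi_1\cdots\pi_i)\ge 0$ for all $i\in[n]$. A permutation in $\mathcal S_n$ is an odd order permutation if all its cycles (including fixed points) have odd length. For a cycle $c=(c_1c_2\cdots c_k)$, put $\mathrm{cdes}(c)=|\{i\in[k]: c_i>c_{i+1}\}|$ with $c_{k+1}=c_1$, and $\mathrm{casc}(c)=k-\mathrm{cdes}(c)$. Define $M(\pi)=\sum_c\min(\mathrm{cdes}(c),\mathrm{casc}(c))$, the sum over all cycles $c$ of $\pi$. A word $u$ is a factor of a word $w$ if $w=xuy$ for some words $x,y$ (possibly empty). A word $u$ is a cyclic factor of $\pi\in\mathcal S_n$ if $u$ is a factor of some word $v$ such that $(v)$ is a cycle of $\pi$ (any cyclic rotation of the cycle notation is allowed). $b_{n,d}(i,j)$ is the number of ballot permutations of length $n$ with $d$ descents which have the three-letter word $i\,n\,j$ as a factor. $p_{n,d}(i,j)$ is the number of odd order permutations $\pi$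 of length $n$ with $M(\pi)=d$ which have $i\,n\,j$ as a cyclic factor. *)

theory Defs
  imports "HOL-Combinatorics.Permutations" "HOL-Library.Sublist"
begin

text \<open>Elements of \<open>S\<^sub>n\<close> are functions \<open>p\<close> with \<^term>\<open>p permutes {1..n}\<close>. List positions count from 0,
  so the paper's position \<open>i\<close> is list index \<open>i - 1\<close>.\<close>

definition one_line :: "nat \<Rightarrow> (nat \<Rightarrow> nat) \<Rightarrow> nat list" where
  "one_line n p = map p [1..<Suc n]"

definition des :: "nat list \<Rightarrow> nat" where
  "des w = card {i. Suc i < length w \<and> w ! i > w ! Suc i}"

definition asc :: "nat list \<Rightarrow> nat" where
  "asc w = card {i. Suc i < length w \<and> w ! i < w ! Suc i}"

definition height :: "nat list \<Rightarrow> int" where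
  "height w = int (asc w) - int (des w)"

definition ballot :: "nat \<Rightarrow> (nat \<Rightarrow> nat) \<Rightarrow> bool" where
  "ballot n p \<longleftrightarrow> p permutes {1..n} \<and> (\<forall>i\<in>{1..n}. height (take i (one_line n p)) \<ge> 0)"

text \<open>\<open>v = c\<^sub>1 \<dots> c\<^sub>k\<close> is a word such that \<open>(c\<^sub>1 \<dots> c\<^sub>k)\<close> is a cycle of \<open>p\<close>; every rotation of \<open>v\<close>
  then is such a word too. Fixed points in \<open>{1..n}\<close> give the words of length 1; the points outside
  \<open>{1..n}\<close>, which \<open>p\<close> fixes as well, are excluded.\<close>

definition cycle_word :: "nat \<Rightarrow> (nat \<Rightarrow> nat) \<Rightarrow> nat list \<Rightarrow> bool" where
  "cycle_word n p v \<longleftrightarrow> v \<noteq> [] \<and> distinct v \<and> set v \<subseteq> {1..n} \<and>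
     (\<forall>i<length v. p (v ! i) = v ! (Suc i mod length v))"

text \<open>Each cycle is represented by the one of its words that starts with its smallest letter, so that
  sums over this set count every cycle once.\<close>

definition cycles_of :: "nat \<Rightarrow> (nat \<Rightarrow> nat) \<Rightarrow> nat list set" where
  "cycles_of n p = {v. cycle_word n p v \<and> hd v = Min (set v)}"

definition odd_order :: "nat \<Rightarrow> (nat \<Rightarrow> nat) \<Rightarrow> bool" where
  "odd_order n p \<longleftrightarrow> p permutes {1..n} \<and> (\<forall>c\<in>cycles_of n p. odd (length c))"

definition cdes :: "nat list \<Rightarrow> nat" where
  "cdes c = card {i. i < length c \<and> c ! i > c ! (Suc i mod length c)}"

definition casc :: "nat list \<Rightarrow> nat" where
  "casc c = length c - cdes c"

definition M_stat :: "nat \<Rightarrow> (nat \<Rightarrow> nat) \<Rightarrow> nat" where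
  "M_stat n p = (\<Sum>c\<in>cycles_of n p. min (cdes c) (casc c))"

text \<open>The library's \<^term>\<open>sublist u w\<close> says that \<open>u\<close> is a contiguous factor of \<open>w\<close>.\<close>

definition cyclic_factor :: "nat \<Rightarrow> nat list \<Rightarrow> (nat \<Rightarrow> nat) \<Rightarrow> bool" where
  "cyclic_factor n u p \<longleftrightarrow> (\<exists>v. cycle_word n p v \<and> sublist u v)"

definition ballot_count :: "nat \<Rightarrow> nat \<Rightarrow> nat \<Rightarrow> nat \<Rightarrow> nat" where
  "ballot_count n d i j = card {\<pi>. ballot n \<pi> \<and> des (one_line n \<pi>) = d \<and> sublist [i, n, j] (one_line n \<pi>)}"

definition odd_count :: "nat \<Rightarrow> nat \<Rightarrow> nat \<Rightarrow> nat \<Rightarrow> nat" where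
  "odd_count n d i j = card {\<pi>. odd_order n \<pi> \<and> M_stat n \<pi> = d \<and> cyclic_factor n [i, n, j] \<pi>}"

end

(* Height-weighted words turn the count into an identity in the ring of functions on finite sets of
   letters (product = sum over ordered splittings of the set) with Laurent polynomial values. A word
   is cut at its first or its last minimum of height; the left piece is a ballot word read backwards
   and the right piece is a ballot word, so (words with one free step) = (reverse ballot) * (ballot).
   This uses only that steps are antisymmetric, not that they come from an order. Hence it applies as
   well after forcing every step into j to be a descent (this encodes the factor 1 n j: delete 1 n),
   or every step out of j to be an ascent (the factor j n 1). Splitting these forced words at j and
   a sign-reversing telescoping sum over reversed suffixes show that the two marked products add up
   to twice the cycles of odd length through j times (reverse ballot) * (ballot). Ballot words have
   positive exponents and reverse ballot words negative ones, so comparing positive parts gives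
   marked ballot words = 2 * (odd cycle through j) * (ballot words). With j minimal this is the
   recursion of odd order permutations, which identifies the last factor with them. *)
theory Submission
  imports Defs "HOL-Combinatorics.Multiset_Permutations" "HOL-Combinatorics.Cycles"
    "HOL-Library.Poly_Mapping"
begin

text \<open>Each marked product is on its own a multiple of (reverse ballot) * (ballot). In the
  multiplier, a word of length l and height h that starts with the marked letter contributes q^(h-1)
  + (-1)^(l-1) q^(1-h) for the factor 1 n j, and q^(1-h) + (-1)^(l-1) q^(h-1) for j n 1. For even l
  the two contributions cancel, for odd l they agree. This is why only the sum over both orders is a
  statement about odd cycles, and where the factor 2 comes from. The minimum in M arises from taking
  positive exponents. If the marked letter is the smallest of its cycle, closing the cycle adds a
  descent, so h - 1 = casc - cdes, and its absolute value is length - 2 min(cdes, casc). A ballot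
  word has weight q^(length - 2 des). Hence both counts are coefficients of the same power q^(n-2d).
  Ballot words have no such product formula by themselves; the reverse ballot words are carried
  along only to obtain one. The separation works because both factors take the value 1 on the empty
  set, so induction on the set isolates leading values.\<close>

section \<open>The ring of set functions\<close>

text \<open>Functions vanish on infinite sets, where the sum over all splittings would be junk and \<open>1\<close>
  would not be neutral.\<close>

typedef (overloaded) ('b, 'r::zero) setfun = "{f :: 'b set \<Rightarrow> 'r. \<forall>S. infinite S \<longrightarrow> f S = 0}"
  morphisms value_at Abs_setfun
  by (rule exI[of _ "\<lambda>_. 0"]) simp

setup_lifting type_definition_setfun

lemma value_at_infinite [simp]: "infinite S \<Longrightarrow> value_at f S = 0"
  using value_at[of f] by simp

lemma setfun_eqI: "(\<And>S. finite S \<Longrightarrow> value_at f S = value_at g S) \<Longrightarrow> f = g"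
  by (metis value_at_inject value_at_infinite ext)

lemma sum_Pow_complement:
  "(\<Sum>A\<in>Pow S. f A (S - A)) = (\<Sum>A\<in>Pow S. f (S - A) A)"
  by (rule sum.reindex_bij_witness[of _ "\<lambda>A. S - A" "\<lambda>A. S - A"]) (auto simp: double_diff)

text \<open>Both sides run over the ordered splittings of \<open>S\<close> into three blocks; the
  left side picks the union of the first two blocks first.\<close>

lemma sum_Pow_assoc:
  assumes "finite S"
  shows "(\<Sum>A\<in>Pow S. \<Sum>B\<in>Pow A. f B (A - B) (S - A))
       = (\<Sum>B\<in>Pow S. \<Sum>C\<in>Pow (S - B). f B C (S - B - C))"
proof -
  have fin: "finite A" if "A \<in> Pow S" for A
    using assms that by (auto intro: finite_subset)
  have "(\<Sum>A\<in>Pow S. \<Sum>B\<in>Pow A. f B (A - B) (S - A))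
      = (\<Sum>(A, B)\<in>Sigma (Pow S) Pow. f B (A - B) (S - A))"
    using fin assms by (subst sum.Sigma) auto
  also have "\<dots> = (\<Sum>(B, C)\<in>(SIGMA B:Pow S. Pow (S - B)). f B C (S - B - C))"
    by (rule sum.reindex_bij_witness[of _ "\<lambda>(B, C). (B \<union> C, B)" "\<lambda>(A, B). (B, A - B)"])
      (auto intro!: arg_cong2[of _ _ _ _ "f _"])
  also have "\<dots> = (\<Sum>B\<in>Pow S. \<Sum>C\<in>Pow (S - B). f B C (S - B - C))"
    using assms by (subst sum.Sigma) auto
  finally show ?thesis .
qed

instantiation setfun :: (type, comm_ring_1) comm_ring_1
begin

lift_definition zero_setfun :: "('a, 'b) setfun" is "\<lambda>_. 0" by simp
lift_definition one_setfun :: "('a, 'b) setfun" is "\<lambda>S. if S = {} then 1 else 0" by auto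
lift_definition plus_setfun :: "('a, 'b) setfun \<Rightarrow> ('a, 'b) setfun \<Rightarrow> ('a, 'b) setfun"
  is "\<lambda>f g S. f S + g S" by simp
lift_definition minus_setfun :: "('a, 'b) setfun \<Rightarrow> ('a, 'b) setfun \<Rightarrow> ('a, 'b) setfun"
  is "\<lambda>f g S. f S - g S" by simp
lift_definition uminus_setfun :: "('a, 'b) setfun \<Rightarrow> ('a, 'b) setfun"
  is "\<lambda>f S. - f S" by simp
lift_definition times_setfun :: "('a, 'b) setfun \<Rightarrow> ('a, 'b) setfun \<Rightarrow> ('a, 'b) setfun"
  is "\<lambda>f g S. \<Sum>A\<in>Pow S. f A * g (S - A)"
  by simp

instance
proof
  fix a b c :: "('a, 'b) setfun"
  show "a * b * c = a * (b * c)"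
  proof (rule setfun_eqI)
    fix S :: "'a set" assume "finite S"
    from sum_Pow_assoc[OF this, of "\<lambda>A B C. value_at a A * value_at b B * value_at c C"]
    show "value_at (a * b * c) S = value_at (a * (b * c)) S"
      by (simp add: times_setfun.rep_eq sum_distrib_left sum_distrib_right mult.assoc)
  qed
  show "a * b = b * a"
  proof (rule setfun_eqI)
    fix S :: "'a set"
    from sum_Pow_complement[of "\<lambda>A B. value_at a A * value_at b B" S]
    show "value_at (a * b) S = value_at (b * a) S"
      by (simp add: times_setfun.rep_eq mult.commute)
  qed
  show "1 * a = a"
  proof (rule setfun_eqI)
    fix S :: "'a set" assume S: "finite S"
    have "value_at (1 * a) S = (\<Sum>A\<in>Pow S. if A = {} then value_at a S else 0)"
      by (auto simp: times_setfun.rep_eq one_setfun.rep_eq intro!: sum.cong)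
    also have "\<dots> = value_at a S" using S by simp
    finally show "value_at (1 * a) S = value_at a S" .
  qed
  show "(a + b) * c = a * c + b * c"
    by (rule setfun_eqI) (simp add: times_setfun.rep_eq plus_setfun.rep_eq distrib_right sum.distrib)
  show "(0 :: ('a, 'b) setfun) \<noteq> 1"
    by transfer (metis zero_neq_one)
qed (transfer; simp add: fun_eq_iff algebra_simps)+

end

lemma value_at_add: "value_at (f + g) S = value_at f S + value_at g S"
  by (simp add: plus_setfun.rep_eq)

lemma value_at_diff: "value_at (f - g) S = value_at f S - value_at g S"
  by (simp add: minus_setfun.rep_eq)

lemma value_at_mult: "value_at (f * g) S = (\<Sum>A\<in>Pow S. value_at f A * value_at g (S - A))"
  by (simp add: times_setfun.rep_eq)

lift_definition wsum :: "('b list \<Rightarrow> 'r::comm_ring_1) \<Rightarrow> ('b, 'r) setfun"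
  is "\<lambda>\<phi> S. \<Sum>w\<in>permutations_of_set S. \<phi> w"
  by (simp add: permutations_of_set_infinite)

lemma value_at_wsum: "value_at (wsum \<phi>) S = (\<Sum>w\<in>permutations_of_set S. \<phi> w)"
  by (simp add: wsum.rep_eq)

lemma wsum_cong: "(\<And>w. distinct w \<Longrightarrow> \<phi> w = \<psi> w) \<Longrightarrow> wsum \<phi> = wsum \<psi>"
  by (rule setfun_eqI) (auto simp: value_at_wsum permutations_of_set_def intro!: sum.cong)

lemma wsum_add: "wsum \<phi> + wsum \<psi> = wsum (\<lambda>w. \<phi> w + \<psi> w)"
  by (rule setfun_eqI) (simp add: value_at_add value_at_wsum sum.distrib)

text \<open>Reversal permutes the arrangements of a set. With antisymmetric steps it negates
  heights, so it trades q for 1/q in a word sum.\<close>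

lemma wsum_rev: "wsum (\<lambda>w. \<phi> (rev w)) = wsum \<phi>"
  by (rule setfun_eqI, unfold value_at_wsum, rule sum.reindex_bij_witness[of _ rev rev])
    (auto simp: permutations_of_set_def)

lemma wsum_one: "wsum (\<lambda>w. if w = [] then 1 else 0) = 1"
proof (rule setfun_eqI)
  fix S :: "'a set"
  show "value_at (wsum (\<lambda>w. if w = [] then 1 else 0)) S = value_at 1 S"
  proof (cases "S = {}")
    case False
    then have "w \<noteq> []" if "w \<in> permutations_of_set S" for w
      using that by (auto simp: permutations_of_set_def)
    with False show ?thesis
      by (simp add: value_at_wsum one_setfun.rep_eq)
  qed (simp add: value_at_wsum one_setfun.rep_eq)
qed

text \<open>A splitting of \<open>S\<close> with an arrangement of each block is the same thing as
  an arrangement of \<open>S\<close> with a cut position. Every product identity below is thereby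
  reduced to a sum over the cuts of one fixed word.\<close>

lemma wsum_mult:
  "wsum \<phi> * wsum \<psi> = wsum (\<lambda>w. \<Sum>i\<le>length w. \<phi> (take i w) * \<psi> (drop i w))"
proof (rule setfun_eqI)
  fix S :: "'a set" assume S: "finite S"
  let ?P = permutations_of_set
  let ?A = "SIGMA A:Pow S. ?P A \<times> ?P (S - A)"
  have "value_at (wsum \<phi> * wsum \<psi>) S = (\<Sum>A\<in>Pow S. \<Sum>(x, y)\<in>?P A \<times> ?P (S - A). \<phi> x * \<psi> y)"
    by (simp add: value_at_mult value_at_wsum sum_product sum.cartesian_product)
  also have "\<dots> = (\<Sum>(A, x, y)\<in>?A. \<phi> x * \<psi> y)"
    using S by (subst sum.Sigma) auto
  also have "\<dots> = (\<Sum>(w, i)\<in>(SIGMA w:?P S. {..length w}). \<phi> (take i w) * \<psi> (drop i w))"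
    by (rule sum.reindex_bij_witness[of _ "\<lambda>(w, i). (set (take i w), take i w, drop i w)"
          "\<lambda>(A, x, y). (x @ y, length x)"])
      (auto simp: permutations_of_set_def set_take_subset set_drop_subset
        dest: in_set_takeD in_set_dropD, 
        (metis append_take_drop_id distinct_append disjoint_iff set_append Un_iff)+)
  also have "\<dots> = value_at (wsum (\<lambda>w. \<Sum>i\<le>length w. \<phi> (take i w) * \<psi> (drop i w))) S"
    by (simp add: value_at_wsum sum.Sigma)
  finally show "value_at (wsum \<phi> * wsum \<psi>) S
    = value_at (wsum (\<lambda>w. \<Sum>i\<le>length w. \<phi> (take i w) * \<psi> (drop i w))) S" .
qed

lift_definition const :: "'r::zero \<Rightarrow> ('b, 'r) setfun"
  is "\<lambda>c S. if S = {} then c else 0" by auto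

lemma value_at_const_mult: "value_at (const c * f) S = c * value_at f S"
proof (cases "finite S")
  case True
  have "value_at (const c * f) S = (\<Sum>A\<in>Pow S. if A = {} then c * value_at f S else 0)"
    by (auto simp: value_at_mult const.rep_eq intro!: sum.cong)
  then show ?thesis using True by simp
qed simp

lemma const_mult_wsum: "const c * wsum \<phi> = wsum (\<lambda>w. c * \<phi> w)"
  by (rule setfun_eqI) (simp add: value_at_const_mult value_at_wsum sum_distrib_left)

lemma const_add: "const (a + b) = const a + (const b :: ('b, 'r::comm_ring_1) setfun)"
  by (rule setfun_eqI) (simp add: value_at_add const.rep_eq)

section \<open>Heights of words for an arbitrary step function\<close>

fun hgt :: "('b \<Rightarrow> 'b \<Rightarrow> int) \<Rightarrow> 'b list \<Rightarrow> int" where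
  "hgt c [] = 0"
| "hgt c [a] = 0"
| "hgt c (a # b # w) = c a b + hgt c (b # w)"

definition bal :: "('b \<Rightarrow> 'b \<Rightarrow> int) \<Rightarrow> 'b list \<Rightarrow> bool" where
  "bal c w \<longleftrightarrow> (\<forall>i\<le>length w. 0 \<le> hgt c (take i w))"

text \<open>For antisymmetric \<open>c\<close> and distinct letters this says that
  \<open>rev w\<close> is ballot. The suffix form also makes sense for the forced step functions,
  which are not antisymmetric.\<close>

definition rbal :: "('b \<Rightarrow> 'b \<Rightarrow> int) \<Rightarrow> 'b list \<Rightarrow> bool" where
  "rbal c w \<longleftrightarrow> (\<forall>i\<le>length w. hgt c (drop i w) \<le> 0)"

text \<open>The diagonal is left out because a step of value 1 or -1 cannot be its own
  negative.\<close>

definition antisym_step :: "('b \<Rightarrow> 'b \<Rightarrow> int) \<Rightarrow> bool" where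
  "antisym_step c \<longleftrightarrow> (\<forall>a b. a \<noteq> b \<longrightarrow> c b a = - c a b)"

definition unit_step :: "('b \<Rightarrow> 'b \<Rightarrow> int) \<Rightarrow> bool" where
  "unit_step c \<longleftrightarrow> (\<forall>a b. c a b = 1 \<or> c a b = - 1)"

lemma hgt_append:
  "u \<noteq> [] \<Longrightarrow> v \<noteq> [] \<Longrightarrow> hgt c (u @ v) = hgt c u + c (last u) (hd v) + hgt c v"
proof (induction c u rule: hgt.induct)
  case (2 c a)
  then show ?case by (cases v) auto
qed auto

lemma hgt_Cons: "w \<noteq> [] \<Longrightarrow> hgt c (a # w) = c a (hd w) + hgt c w"
  by (cases w) auto

lemma hgt_snoc: "w \<noteq> [] \<Longrightarrow> hgt c (w @ [a]) = hgt c w + c (last w) a"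
  by (simp add: hgt_append)

lemma hgt_rev:
  assumes "antisym_step c"
  shows "distinct w \<Longrightarrow> hgt c (rev w) = - hgt c w"
proof (induction w)
  case (Cons a w)
  show ?case
  proof (cases "w = []")
    case False
    then have "a \<noteq> hd w" using Cons.prems by auto
    then have "c (hd w) a = - c a (hd w)"
      using assms unfolding antisym_step_def by blast
    with False Cons show ?thesis by (simp add: hgt_snoc hgt_Cons last_rev)
  qed simp
qed simp

lemma hgt_cong:
  assumes "\<And>a b. a \<in> set w \<Longrightarrow> b \<in> set w \<Longrightarrow> a \<noteq> b \<Longrightarrow> c a b = c' a b" and "distinct w"
  shows "hgt c w = hgt c' w"
  using assms
proof (induction w)
  case (Cons a w)
  show ?case
  proof (cases "w = []")
    case False
    then have "hd w \<in> set w" by simp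
    moreover from this have "a \<noteq> hd w" using Cons.prems by auto
    ultimately have "c a (hd w) = c' a (hd w)"
      using Cons.prems(1) by auto
    with False Cons show ?thesis by (simp add: hgt_Cons)
  qed simp
qed simp

lemma bal_cong:
  assumes "\<And>a b. a \<in> set w \<Longrightarrow> b \<in> set w \<Longrightarrow> a \<noteq> b \<Longrightarrow> c a b = c' a b" and "distinct w"
  shows "bal c w = bal c' w"
proof -
  have "hgt c (take i w) = hgt c' (take i w)" for i
    using assms by (intro hgt_cong) (auto dest: in_set_takeD)
  then show ?thesis by (simp add: bal_def)
qed

lemma rbal_cong:
  assumes "\<And>a b. a \<in> set w \<Longrightarrow> b \<in> set w \<Longrightarrow> a \<noteq> b \<Longrightarrow> c a b = c' a b" and "distinct w"
  shows "rbal c w = rbal c' w"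
proof -
  have "hgt c (drop i w) = hgt c' (drop i w)" for i
    using assms by (intro hgt_cong) (auto dest: in_set_dropD)
  then show ?thesis by (simp add: rbal_def)
qed

lemma hgt_split:
  assumes "0 < i" and "i < length w"
  shows "hgt c w = hgt c (take i w) + c (w ! (i - 1)) (w ! i) + hgt c (drop i w)"
proof -
  have "hgt c (take i w @ drop i w)
      = hgt c (take i w) + c (last (take i w)) (hd (drop i w)) + hgt c (drop i w)"
    using assms by (intro hgt_append) auto
  moreover have "last (take i w) = w ! (i - 1)"
    using assms by (subst last_conv_nth) auto
  ultimately show ?thesis
    using assms by (simp add: hd_drop_conv_nth)
qed

lemma hgt_take_Suc:
  assumes "0 < i" and "i < length w"
  shows "hgt c (take (Suc i) w) = hgt c (take i w) + c (w ! (i - 1)) (w ! i)"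
  using hgt_split[of i "take (Suc i) w" c] assms
  by (simp add: min_def take_Suc_conv_app_nth nth_append)

text \<open>The factor starts at the letter of index \<open>i\<close>, whose level is the height of
  the prefix of length \<open>Suc i\<close>; the step into that letter lies outside the
  factor.\<close>

lemma hgt_segment:
  assumes "i < l" and "l \<le> length w"
  shows "hgt c (take (l - i) (drop i w)) = hgt c (take l w) - hgt c (take (Suc i) w)"
proof (cases "l = Suc i")
  case True
  then show ?thesis using assms by (simp add: take_Suc hd_drop_conv_nth)
next
  case False
  have split: "take l w = take i w @ take (l - i) (drop i w)"
    using assms by (metis le_add_diff_inverse less_imp_le take_add)
  show ?thesis
  proof (cases "i = 0")
    case True
    then show ?thesis using assms by (cases w) auto
  next
    case i: False
    then have "hgt c (take l w) = hgt c (take i w) + c (w ! (i - 1)) (w ! i)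
        + hgt c (take (l - i) (drop i w))"
      using hgt_split[of i "take l w" c] assms by (simp add: min_def drop_take)
    with i assms show ?thesis by (simp add: hgt_take_Suc)
  qed
qed

section \<open>Laurent monomial weights and the cut at a minimum of height\<close>

definition qpow :: "int \<Rightarrow> int \<Rightarrow>\<^sub>0 int" where
  "qpow z = Poly_Mapping.single z 1"

lemma qpow_mult: "qpow a * qpow b = qpow (a + b)"
  by (simp add: qpow_def mult_single)

lemma qpow_0: "qpow 0 = 1"
  by (simp add: qpow_def)

text \<open>The shifts by one account for the step at the cut between the two pieces: over its two
  possible directions the junction contributes \<open>q + 1/q\<close>, and a cut at the first minimum is preceded
  by a descent, a cut at the last minimum followed by an ascent.\<close>

definition bal_wt :: "('b \<Rightarrow> 'b \<Rightarrow> int) \<Rightarrow> 'b list \<Rightarrow> int \<Rightarrow>\<^sub>0 int" where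
  "bal_wt c w = (if w = [] then 1 else if bal c w then qpow (hgt c w + 1) else 0)"

definition rbal_wt :: "('b \<Rightarrow> 'b \<Rightarrow> int) \<Rightarrow> 'b list \<Rightarrow> int \<Rightarrow>\<^sub>0 int" where
  "rbal_wt c w = (if w = [] then 1 else if rbal c w then qpow (hgt c w - 1) else 0)"

definition word_wt :: "('b \<Rightarrow> 'b \<Rightarrow> int) \<Rightarrow> 'b list \<Rightarrow> int \<Rightarrow>\<^sub>0 int" where
  "word_wt c w = (if w = [] then 1 else (qpow 1 + qpow (- 1)) * qpow (hgt c w))"

text \<open>The strict inequality before \<open>i\<close> and the weak one after it single out the
  first minimum. As a singleton set, it turns a sum of indicators over all cuts into one
  term.\<close>

lemma ex1_first_argmin:
  fixes H :: "nat \<Rightarrow> int"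
  assumes "0 < n"
  shows "\<exists>i. {i. i < n \<and> (\<forall>j<i. H i < H j) \<and> (\<forall>j. i \<le> j \<and> j < n \<longrightarrow> H i \<le> H j)} = {i}"
proof -
  define M where "M = Min (H ` {..<n})"
  have M: "M \<le> H j" if "j < n" for j
    using that by (auto simp: M_def)
  have "M \<in> H ` {..<n}"
    unfolding M_def using assms by (intro Min_in) auto
  then have ex: "\<exists>i. i < n \<and> H i = M" by auto
  define i where "i = (LEAST i. i < n \<and> H i = M)"
  have i: "i < n" "H i = M"
    using LeastI_ex[OF ex] by (auto simp: i_def)
  have less: "H i < H j" if "j < i" for j
    using not_less_Least[of j "\<lambda>i. i < n \<and> H i = M"] that i M[of j] by (auto simp: i_def)
  have uniq: "i' = i" if "i' < n" "\<forall>j<i'. H i' < H j" "\<forall>j. i' \<le> j \<and> j < n \<longrightarrow> H i' \<le> H j" for i'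
  proof (rule antisym)
    show "i' \<le> i"
    proof (rule ccontr)
      assume "\<not> i' \<le> i"
      then have "H i' < H i" using that(2) by simp
      then show False using i(2) M[OF that(1)] by simp
    qed
    show "i \<le> i'"
    proof (rule ccontr)
      assume "\<not> i \<le> i'"
      then have "H i' \<le> H i" "H i < H i'" using that(3) i(1) less by simp_all
      then show False by simp
    qed
  qed
  show ?thesis (is "\<exists>i. ?S = {i}")
  proof (intro exI equalityI)
    show "?S \<subseteq> {i}" using uniq by blast
    show "{i} \<subseteq> ?S" using i less M by simp
  qed
qed

text \<open>The last minimum is the first minimum of the sequence read backwards, with index
  \<open>n - 1 - i\<close>.\<close>

lemma ex1_last_argmin:
  fixes H :: "nat \<Rightarrow> int"
  assumes "0 < n"
  shows "\<exists>i. {i. i < n \<and> (\<forall>j\<le>i. H i \<le> H j) \<and> (\<forall>j. i < j \<and> j < n \<longrightarrow> H i < H j)} = {i}"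
proof -
  from ex1_first_argmin[OF assms, of "\<lambda>j. H (n - 1 - j)"] obtain k where
    k: "{i. i < n \<and> (\<forall>j<i. H (n - 1 - i) < H (n - 1 - j)) \<and>
         (\<forall>j. i \<le> j \<and> j < n \<longrightarrow> H (n - 1 - i) \<le> H (n - 1 - j))} = {k}" (is "?L = _")
    by (elim exE)
  have "{i. i < n \<and> (\<forall>j\<le>i. H i \<le> H j) \<and> (\<forall>j. i < j \<and> j < n \<longrightarrow> H i < H j)}
      = (\<lambda>i. n - 1 - i) ` ?L" (is "?R = _")
  proof (intro equalityI subsetI)
    fix i assume i: "i \<in> ?R"
    have "n - 1 - i \<in> ?L"
    proof (intro CollectI conjI allI impI)
      show "n - 1 - i < n" using assms by simp
      fix j
      show "H (n - 1 - (n - 1 - i)) < H (n - 1 - j)" if "j < n - 1 - i"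
        using i that by auto
      show "H (n - 1 - (n - 1 - i)) \<le> H (n - 1 - j)" if "n - 1 - i \<le> j \<and> j < n"
        using i that by auto
    qed
    moreover have "i = n - 1 - (n - 1 - i)" using i by auto
    ultimately show "i \<in> (\<lambda>i. n - 1 - i) ` ?L" by blast
  next
    fix i assume "i \<in> (\<lambda>i. n - 1 - i) ` ?L"
    then obtain i' where i': "i' \<in> ?L" "i = n - 1 - i'" by blast
    show "i \<in> ?R"
    proof (intro CollectI conjI allI impI)
      show "i < n" using i' assms by auto
      fix j
      show "H i \<le> H j" if "j \<le> i"
      proof -
        from i' that have "i' \<le> n - 1 - j" "n - 1 - j < n" "n - 1 - (n - 1 - j) = j" by auto
        with i' show ?thesis by fastforce
      qed
      show "H i < H j" if "i < j \<and> j < n"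
      proof -
        from i' that have "n - 1 - j < i'" "n - 1 - (n - 1 - j) = j" by auto
        with i' show ?thesis by fastforce
      qed
    qed
  qed
  then show ?thesis
    unfolding k by blast
qed

text \<open>The level of the letter of index \<open>j\<close> is
  \<open>hgt c (take (Suc j) w)\<close>. A suffix is ballot when its first letter has the lowest
  level in it; \<open>rbal_take_iff\<close> is the dual statement for the last letter of a
  prefix.\<close>

lemma bal_drop_iff:
  assumes "i < length w"
  shows "bal c (drop i w) \<longleftrightarrow>
    (\<forall>j. i \<le> j \<and> j < length w \<longrightarrow> hgt c (take (Suc i) w) \<le> hgt c (take (Suc j) w))"
    (is "_ \<longleftrightarrow> ?R")
proof
  assume bal: "bal c (drop i w)"
  show ?R
  proof (intro allI impI)
    fix j assume j: "i \<le> j \<and> j < length w"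
    from bal j have "0 \<le> hgt c (take (Suc j - i) (drop i w))"
      by (auto simp: bal_def)
    with j show "hgt c (take (Suc i) w) \<le> hgt c (take (Suc j) w)"
      by (subst (asm) hgt_segment) auto
  qed
next
  assume R: ?R
  show "bal c (drop i w)"
    unfolding bal_def
  proof (intro allI impI)
    fix l assume l: "l \<le> length (drop i w)"
    show "0 \<le> hgt c (take l (drop i w))"
    proof (cases l)
      case (Suc l')
      then have "hgt c (take l (drop i w)) = hgt c (take (i + l) w) - hgt c (take (Suc i) w)"
        using hgt_segment[of i "i + l" w c] l assms by auto
      with R[rule_format, of "i + l'"] l Suc assms show ?thesis by auto
    qed simp
  qed
qed

lemma rbal_take_iff:
  assumes "0 < i" and "i \<le> length w"
  shows "rbal c (take i w) \<longleftrightarrow> (\<forall>j<i. hgt c (take i w) \<le> hgt c (take (Suc j) w))"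
proof -
  have seg: "hgt c (drop j (take i w)) = hgt c (take i w) - hgt c (take (Suc j) w)" if "j < i" for j
    using hgt_segment[OF that assms(2), of c] by (simp add: drop_take)
  have "rbal c (take i w) \<longleftrightarrow> (\<forall>j<i. hgt c (drop j (take i w)) \<le> 0)"
    unfolding rbal_def using assms by (auto simp: le_less)
  then show ?thesis using seg by auto
qed

text \<open>The conditions on the two pieces only compare levels weakly within each piece. The
  junction step has value 1 or -1, and this makes the comparison with the other piece strict: after
  a descent the first letter of the right piece is the first minimum of the whole word, before an
  ascent the last letter of the left piece is the last minimum. Every other cut has weight
  0.\<close>

lemma first_last_min_split:
  assumes c: "unit_step c" and w: "w \<noteq> []"
  shows "(\<Sum>i\<le>length w. rbal_wt c (take i w) * bal_wt c (drop i w)) = word_wt c w"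
proof -
  define n where "n = length w"
  define H where "H j = hgt c (take (Suc j) w)" for j
  define first where "first = {i. i < n \<and> (\<forall>j<i. H i < H j) \<and> (\<forall>j. i \<le> j \<and> j < n \<longrightarrow> H i \<le> H j)}"
  define last where "last = {i. i < n \<and> (\<forall>j\<le>i. H i \<le> H j) \<and> (\<forall>j. i < j \<and> j < n \<longrightarrow> H i < H j)}"
  have n: "0 < n" using w by (simp add: n_def)
  have hw: "hgt c w = H (n - 1)"
    using n by (simp add: H_def n_def)
  have H0: "H 0 = 0" using w by (cases w) (auto simp: H_def)
  have step: "H i = H (i - 1) + 1 \<or> H i = H (i - 1) - 1" if "0 < i" "i < n" for i
  proof -
    have "H i = H (i - 1) + c (w ! (i - 1)) (w ! i)"
      using hgt_take_Suc[of i w c] that by (simp add: H_def n_def)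
    moreover have "c (w ! (i - 1)) (w ! i) = 1 \<or> c (w ! (i - 1)) (w ! i) = - 1"
      using c by (simp add: unit_step_def)
    ultimately show ?thesis by linarith
  qed
  \<comment> \<open>The cut after the last minimum is one larger than the index of that minimum,
    hence the image under \<open>Suc\<close>.\<close>
  have last_iff: "i \<in> Suc ` last \<longleftrightarrow>
      i \<le> n \<and> (\<forall>j<i. H (i - 1) \<le> H j) \<and> (\<forall>j. i \<le> j \<and> j < n \<longrightarrow> H (i - 1) < H j)"
    if "0 < i" for i
  proof -
    have "i \<in> Suc ` last \<longleftrightarrow> i - 1 \<in> last"
      using that by (metis Suc_diff_1 imageE diff_Suc_1 image_eqI)
    moreover have "j \<le> i - 1 \<longleftrightarrow> j < i" "i - 1 < j \<longleftrightarrow> i \<le> j" for j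
      using that by auto
    ultimately show ?thesis using that by (auto simp: last_def)
  qed
  have summand: "rbal_wt c (take i w) * bal_wt c (drop i w)
    = (if i \<in> first then qpow (H (n - 1) + 1) else 0)
    + (if i \<in> Suc ` last then qpow (H (n - 1) - 1) else 0)" if i: "i \<le> n" for i
  proof -
    \<comment> \<open>At the two extreme cuts one piece is empty with weight 1 and there is no
      junction: cut 0 can only see a first minimum at index 0, cut \<open>n\<close> only a last
      minimum at index \<open>n - 1\<close>.\<close>
    consider "i = 0" | "i = n" | "0 < i" "i < n" using i by linarith
    then show ?thesis
    proof cases
      case 1
      then have "bal c w \<longleftrightarrow> i \<in> first"
        using bal_drop_iff[of 0 w c] n by (simp add: first_def H_def n_def)
      moreover have "i \<notin> Suc ` last" using 1 by blast
      ultimately show ?thesis using 1 w by (simp add: rbal_wt_def bal_wt_def hw)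
    next
      case 2
      then have "rbal c w \<longleftrightarrow> i \<in> Suc ` last"
        using rbal_take_iff[of n w c] n hw[symmetric] by (simp add: last_iff n_def) (simp add: H_def)
      moreover have "i \<notin> first" using 2 by (simp add: first_def)
      ultimately show ?thesis using 2 w by (simp add: rbal_wt_def bal_wt_def hw n_def)
    next
      case 3
      have R: "rbal c (take i w) \<longleftrightarrow> (\<forall>j<i. H (i - 1) \<le> H j)"
        using rbal_take_iff[of i w c] 3 by (simp add: H_def n_def)
      have B: "bal c (drop i w) \<longleftrightarrow> (\<forall>j. i \<le> j \<and> j < n \<longrightarrow> H i \<le> H j)"
        using bal_drop_iff[of i w c] 3 by (simp add: H_def n_def)
      have hd: "hgt c (drop i w) = H (n - 1) - H i"
        using hgt_segment[of i n w c] 3 by (simp add: n_def H_def)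
      have ht: "hgt c (take i w) = H (i - 1)" using 3 by (simp add: H_def)
      \<comment> \<open>The shifts -1 and +1 of the two weights cancel, so the exponent is the total
        height minus the junction step.\<close>
      have lhs: "rbal_wt c (take i w) * bal_wt c (drop i w) =
        (if (\<forall>j<i. H (i - 1) \<le> H j) \<and> (\<forall>j. i \<le> j \<and> j < n \<longrightarrow> H i \<le> H j)
         then qpow (H (n - 1) - (H i - H (i - 1))) else 0)"
        using 3 by (auto simp: rbal_wt_def bal_wt_def R B hd ht qpow_mult n_def algebra_simps)
      have "H i < H (i - 1)" if "i \<in> first"
        using 3 that by (simp add: first_def)
      moreover have "H (i - 1) < H i" if "i \<in> Suc ` last"
        using 3 that by (subst (asm) last_iff) auto
      ultimately have H_i: "H (i - 1) < H i \<Longrightarrow> i \<notin> first" "H i < H (i - 1) \<Longrightarrow> i \<notin> Suc ` last"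
        by force+
      from step[OF 3] show ?thesis
      proof
        assume up: "H i = H (i - 1) + 1"
        have e: "i \<in> Suc ` last \<longleftrightarrow>
            (\<forall>j<i. H (i - 1) \<le> H j) \<and> (\<forall>j. i \<le> j \<and> j < n \<longrightarrow> H i \<le> H j)"
          using 3 by (simp add: last_iff up add1_zle_eq)
        show ?thesis unfolding lhs e[symmetric] using H_i(1) up by simp
      next
        assume down: "H i = H (i - 1) - 1"
        have e: "i \<in> first \<longleftrightarrow>
            (\<forall>j<i. H (i - 1) \<le> H j) \<and> (\<forall>j. i \<le> j \<and> j < n \<longrightarrow> H i \<le> H j)"
          using 3 by (auto simp: first_def down)
        show ?thesis unfolding lhs e[symmetric] using H_i(2) down by simp
      qed
    qed
  qed
  obtain a where a: "first = {a}"
    using ex1_first_argmin[OF n, of H] unfolding first_def by blast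
  obtain b where b: "last = {b}"
    using ex1_last_argmin[OF n, of H] unfolding last_def by blast
  have "a < n" "b < n" using a b by (auto simp: first_def last_def)
  have "(\<Sum>i\<le>n. rbal_wt c (take i w) * bal_wt c (drop i w))
    = (\<Sum>i\<le>n. (if i = a then qpow (H (n - 1) + 1) else 0) + (if i = Suc b then qpow (H (n - 1) - 1) else 0))"
    by (rule sum.cong) (simp_all add: summand a b)
  also have "\<dots> = qpow (H (n - 1) + 1) + qpow (H (n - 1) - 1)"
    using \<open>a < n\<close> \<open>b < n\<close> by (simp add: sum.distrib)
  also have "\<dots> = word_wt c w"
    using w by (simp add: word_wt_def hw distrib_right qpow_mult add.commute)
  finally show ?thesis by (simp add: n_def)
qed

section \<open>Products of word sums\<close>

definition into :: "'b \<Rightarrow> ('b \<Rightarrow> 'b \<Rightarrow> int) \<Rightarrow> 'b \<Rightarrow> 'b \<Rightarrow> int" where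
  "into k c a b = (if b = k then - 1 else c a b)"

definition out_of :: "'b \<Rightarrow> ('b \<Rightarrow> 'b \<Rightarrow> int) \<Rightarrow> 'b \<Rightarrow> 'b \<Rightarrow> int" where
  "out_of k c a b = (if a = k then 1 else c a b)"

definition wsum_at :: "'b \<Rightarrow> ('b list \<Rightarrow> 'r::comm_ring_1) \<Rightarrow> ('b, 'r) setfun" where
  "wsum_at k \<phi> = wsum (\<lambda>w. if k \<in> set w then \<phi> w else 0)"

lemma rbal_times_bal:
  assumes "unit_step c"
  shows "wsum (rbal_wt c) * wsum (bal_wt c) = wsum (word_wt c)"
  unfolding wsum_mult
proof (rule wsum_cong)
  fix w :: "'a list"
  show "(\<Sum>i\<le>length w. rbal_wt c (take i w) * bal_wt c (drop i w)) = word_wt c w"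
    using first_last_min_split[OF assms, of w]
    by (cases "w = []") (simp_all add: rbal_wt_def bal_wt_def word_wt_def)
qed

lemma bal_wt_cong:
  assumes "\<And>a b. a \<in> set w \<Longrightarrow> b \<in> set w \<Longrightarrow> a \<noteq> b \<Longrightarrow> c a b = c' a b" and "distinct w"
  shows "bal_wt c w = bal_wt c' w"
  unfolding bal_wt_def using bal_cong[OF assms] hgt_cong[OF assms] by simp

lemma rbal_wt_cong:
  assumes "\<And>a b. a \<in> set w \<Longrightarrow> b \<in> set w \<Longrightarrow> a \<noteq> b \<Longrightarrow> c a b = c' a b" and "distinct w"
  shows "rbal_wt c w = rbal_wt c' w"
  unfolding rbal_wt_def using rbal_cong[OF assms] hgt_cong[OF assms] by simp

text \<open>Only the piece containing \<open>k\<close> can see where \<open>c'\<close> differs from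
  \<open>c\<close>; the other piece has the same weight for both. So this is the cut identity for
  \<open>c'\<close>, sorted by the piece in which \<open>k\<close> lies.\<close>

lemma rbal_times_bal_at:
  assumes c': "unit_step c'"
    and eq: "\<And>a b. a \<noteq> k \<Longrightarrow> b \<noteq> k \<Longrightarrow> c' a b = c a b"
  shows "wsum (rbal_wt c) * wsum_at k (bal_wt c') + wsum_at k (rbal_wt c') * wsum (bal_wt c)
    = wsum_at k (word_wt c')"
  unfolding wsum_at_def wsum_mult wsum_add
proof (rule wsum_cong)
  fix w :: "'a list" assume w: "distinct w"
  let ?s = "\<lambda>i. rbal_wt c (take i w) * (if k \<in> set (drop i w) then bal_wt c' (drop i w) else 0)"
  let ?t = "\<lambda>i. (if k \<in> set (take i w) then rbal_wt c' (take i w) else 0) * bal_wt c (drop i w)"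
  show "(\<Sum>i\<le>length w. ?s i) + (\<Sum>i\<le>length w. ?t i) = (if k \<in> set w then word_wt c' w else 0)"
  proof (cases "k \<in> set w")
    case True
    have "?s i + ?t i = rbal_wt c' (take i w) * bal_wt c' (drop i w)" for i
    proof (cases "k \<in> set (take i w)")
      case k: True
      then have "k \<notin> set (drop i w)"
        using set_take_disj_set_drop_if_distinct[OF w order_refl, of i] by blast
      moreover from this have "bal_wt c (drop i w) = bal_wt c' (drop i w)"
        using w by (intro bal_wt_cong) (metis eq, simp)
      ultimately show ?thesis using k by simp
    next
      case k: False
      then have "k \<in> set (drop i w)"
        using True by (metis UnE append_take_drop_id set_append)
      moreover have "rbal_wt c (take i w) = rbal_wt c' (take i w)"
        using w k by (intro rbal_wt_cong) (metis eq, simp)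
      ultimately show ?thesis using k by simp
    qed
    moreover have "w \<noteq> []" using True by auto
    ultimately show ?thesis
      using True first_last_min_split[OF c', of w] by (simp flip: sum.distrib)
  next
    case False
    then have "k \<notin> set (take i w)" "k \<notin> set (drop i w)" for i
      by (auto dest: in_set_takeD in_set_dropD)
    with False show ?thesis by simp
  qed
qed

section \<open>Signed sums of words starting at the marked letter\<close>

definition head_sum :: "'b \<Rightarrow> ('b \<Rightarrow> 'b \<Rightarrow> int) \<Rightarrow> int \<Rightarrow> ('b, int \<Rightarrow>\<^sub>0 int) setfun" where
  "head_sum k c e = wsum (\<lambda>w. if w \<noteq> [] \<and> hd w = k then qpow (e * hgt c w) else 0)"

text \<open>The sign is the parity of the number of steps. It makes this sum the quotient of
  \<open>head_sum k c (- e)\<close> by the sum of \<open>word_wt c\<close>. The parameter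
  \<open>e\<close> is 1 or -1 and says whether heights are counted in q or in 1/q.\<close>

definition signed_head_sum :: "'b \<Rightarrow> ('b \<Rightarrow> 'b \<Rightarrow> int) \<Rightarrow> int \<Rightarrow> ('b, int \<Rightarrow>\<^sub>0 int) setfun" where
  "signed_head_sum k c e =
    wsum (\<lambda>w. if w \<noteq> [] \<and> hd w = k then (- 1) ^ (length w - 1) * qpow (e * hgt c w) else 0)"

definition ne_sum :: "('b \<Rightarrow> 'b \<Rightarrow> int) \<Rightarrow> ('b, int \<Rightarrow>\<^sub>0 int) setfun" where
  "ne_sum c = wsum (\<lambda>w. if w = [] then 0 else qpow (hgt c w))"

lemma unit_stepD: "unit_step c \<Longrightarrow> c a b = 1 \<or> c a b = - 1"
  by (simp add: unit_step_def)

lemma ne_sum_rev: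
  assumes "antisym_step c"
  shows "ne_sum c = wsum (\<lambda>w. if w = [] then 0 else qpow (- hgt c w))"
  unfolding ne_sum_def
  by (subst wsum_rev[symmetric], rule wsum_cong) (simp add: hgt_rev[OF assms])

lemma word_sum_eq:
  "wsum (word_wt c) = 1 + const (qpow 1 + qpow (- 1)) * ne_sum c"
  unfolding ne_sum_def const_mult_wsum wsum_one[symmetric] wsum_add
  by (rule wsum_cong) (simp add: word_wt_def)

lemma head_sum_rev:
  assumes "antisym_step c"
  shows "head_sum k c (- e) = wsum (\<lambda>w. if w \<noteq> [] \<and> last w = k then qpow (e * hgt c w) else 0)"
  unfolding head_sum_def
  by (subst wsum_rev[symmetric], rule wsum_cong) (simp add: hgt_rev[OF assms] hd_rev)

lemma signed_head_sum_rev: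
  assumes "antisym_step c"
  shows "signed_head_sum k c e = 
    wsum (\<lambda>w. if w \<noteq> [] \<and> last w = k then (- 1) ^ (length w - 1) * qpow (- (e * hgt c w)) else 0)"
  unfolding signed_head_sum_def
  by (subst wsum_rev[symmetric], rule wsum_cong) (simp add: hgt_rev[OF assms] hd_rev)

text \<open>The sum telescopes. In the term for a cut at i > 0, the factor q + 1/q offers both
  directions of the junction step: one direction extends the prefix by this step, the other extends
  the reversed suffix by it. The first gives the value of the right side for m = i, the second that
  for m = i - 1 with the opposite sign.\<close>

lemma alternating_reversal_partial:
  assumes c: "unit_step c" and e: "e = 1 \<or> e = - 1" and "m < length w"
  shows "(\<Sum>i\<le>m. (if i = 0 then 1 else (qpow 1 + qpow (- 1)) * qpow (e * hgt c (take i w))) *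
           ((- 1) ^ i * qpow (- (e * hgt c (drop i w)))))
    = (- 1) ^ m * qpow (e * (hgt c (take (Suc m) w) - hgt c (drop m w)))"
  using assms(3)
proof (induction m)
  case 0
  then show ?case by (cases w) (auto simp: algebra_simps)
next
  case (Suc m)
  let ?c = "c (w ! m) (w ! Suc m)"
  let ?t = "hgt c (take (Suc m) w)" and ?d = "hgt c (drop (Suc m) w)"
  have t: "hgt c (take (Suc (Suc m)) w) = ?t + ?c"
    using hgt_take_Suc[of "Suc m" w c] Suc.prems by simp
  have d: "hgt c (drop m w) = ?c + ?d"
    using Suc.prems hgt_Cons[of "drop (Suc m) w" c "w ! m"]
    by (simp add: Cons_nth_drop_Suc hd_drop_conv_nth)
  \<comment> \<open>Since the junction step and \<open>e\<close> are both 1 or -1, the two exponents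
    are the product and its negative in some order.\<close>
  have q: "qpow 1 + qpow (- 1) = qpow (e * ?c) + qpow (- (e * ?c))"
    using e unit_stepD[OF c, of "w ! m" "w ! Suc m"] by (auto simp: add.commute)
  show ?case
    using Suc
    by (simp add: t d q distrib_right distrib_left mult.assoc[symmetric])
      (simp add: qpow_mult mult.assoc algebra_simps)
qed

text \<open>After reversal the second factor consists of words ending in \<open>k\<close>, so the
  right piece of a cut is never empty and the cuts run up to \<open>length w - 1\<close>. What
  survives the telescoping is the cut that leaves a single letter on the right; its sign cancels
  against the sign of the whole word.\<close>

lemma word_sum_times_signed_head_sum:
  assumes c: "unit_step c" and a: "antisym_step c" and e: "e = 1 \<or> e = - 1"
  shows "wsum (word_wt c) * signed_head_sum k c e = head_sum k c (- e)"
proof -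
  define f where "f w = (if w = [] then 1 else (qpow 1 + qpow (- 1)) * qpow (e * hgt c w))" for w
  \<comment> \<open>For \<open>e = - 1\<close> the left pieces are reversed, which replaces each
    height by its negative.\<close>
  have "wsum (word_wt c) = wsum f"
  proof (cases "e = 1")
    case False
    then have "f (rev w) = word_wt c w" if "distinct w" for w
      using e that by (simp add: f_def word_wt_def hgt_rev[OF a])
    then have "wsum (\<lambda>w. f (rev w)) = wsum (word_wt c)"
      by (rule wsum_cong)
    then show ?thesis by (simp add: wsum_rev)
  qed (auto simp: f_def word_wt_def intro!: wsum_cong)
  moreover have "wsum f * signed_head_sum k c e = head_sum k c (- e)"
    unfolding signed_head_sum_rev[OF a] head_sum_rev[OF a] wsum_mult
  proof (rule wsum_cong)
    fix w :: "'a list"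
    let ?g = "\<lambda>w. if w \<noteq> [] \<and> last w = k
      then (- 1) ^ (length w - 1) * qpow (- (e * hgt c w)) else 0"
    show "(\<Sum>i\<le>length w. f (take i w) * ?g (drop i w))
      = (if w \<noteq> [] \<and> last w = k then qpow (e * hgt c w) else 0)"
    proof (cases "w \<noteq> [] \<and> last w = k")
      case True
      define m where "m = length w - 1"
      have m: "length w = Suc m" using True by (simp add: m_def)
      have s: "f (take i w) * ?g (drop i w) = (- 1) ^ m *
          ((if i = 0 then 1 else (qpow 1 + qpow (- 1)) * qpow (e * hgt c (take i w))) *
           ((- 1) ^ i * qpow (- (e * hgt c (drop i w)))))" if "i \<le> m" for i
      proof -
        have "(- 1 :: int \<Rightarrow>\<^sub>0 int) ^ (m - i) = (- 1) ^ m * (- 1) ^ i"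
          using that by (auto simp: uminus_power_if)
        then show ?thesis using that True m by (auto simp: f_def algebra_simps)
      qed
      have "(\<Sum>i\<le>length w. f (take i w) * ?g (drop i w)) = (\<Sum>i\<le>m. f (take i w) * ?g (drop i w))"
        by (simp add: m)
      also have "\<dots> = (- 1) ^ m * ((- 1) ^ m * qpow (e * (hgt c (take (Suc m) w) - hgt c (drop m w))))"
      proof -
        have "(\<Sum>i\<le>m. f (take i w) * ?g (drop i w)) = (- 1) ^ m *
          (\<Sum>i\<le>m. (if i = 0 then 1 else (qpow 1 + qpow (- 1)) * qpow (e * hgt c (take i w))) *
           ((- 1) ^ i * qpow (- (e * hgt c (drop i w)))))"
          unfolding sum_distrib_left by (rule sum.cong[OF refl], rule s) simp
        then show ?thesis
          using alternating_reversal_partial[OF c e, of m w] m by simp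
      qed
      also have "\<dots> = qpow (e * (hgt c (take (Suc m) w) - hgt c (drop m w)))"
        by (simp add: mult.assoc[symmetric] flip: power_add)
      also have "hgt c (drop m w) = 0"
        using m Cons_nth_drop_Suc[of m w] by (metis drop_all hgt.simps(2) lessI order_refl)
      finally show ?thesis using True m by simp
    next
      case False
      then have "drop i w = [] \<or> last (drop i w) \<noteq> k" if "i \<le> length w" for i
        by (metis drop_eq_Nil last_drop not_le_imp_less drop_Nil)
      with False show ?thesis by (auto intro!: sum.neutral)
    qed
  qed
  ultimately show ?thesis by simp
qed

section \<open>Splitting the forced words at the marked letter\<close>

lemma hgt_into:
  assumes "distinct (u @ k # v)"
  shows "hgt (into k c) (u @ k # v) = hgt c u + (if u = [] then 0 else - 1) + hgt c (k # v)"
proof -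
  have u: "hgt (into k c) u = hgt c u"
    using assms by (intro hgt_cong) (auto simp: into_def)
  have v: "hgt (into k c) v = hgt c v"
    using assms by (intro hgt_cong) (auto simp: into_def)
  have kv: "hgt (into k c) (k # v) = hgt c (k # v)"
  proof (cases "v = []")
    case False
    then have "hd v \<in> set v" by simp
    with assms have "hd v \<noteq> k" by auto
    with False v show ?thesis by (simp add: hgt_Cons into_def)
  qed simp
  show ?thesis
    using u kv by (cases "u = []") (auto simp: hgt_append into_def)
qed

text \<open>The word is cut just before \<open>k\<close>. The forced descent at the cut is the shift
  by \<open>- e\<close>, absent when nothing precedes \<open>k\<close>. The right piece starts with
  \<open>k\<close>, so no step inside it is forced.\<close>

lemma word_sum_into:
  "wsum_at k (\<lambda>w. qpow (e * hgt (into k c) w))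
    = wsum (\<lambda>w. if w = [] then 1 else qpow (e * hgt c w - e)) * head_sum k c e"
  unfolding wsum_at_def head_sum_def wsum_mult
proof (rule wsum_cong)
  fix w :: "'a list" assume w: "distinct w"
  let ?s = "\<lambda>i. (if take i w = [] then 1 else qpow (e * hgt c (take i w) - e)) *
        (if drop i w \<noteq> [] \<and> hd (drop i w) = k then qpow (e * hgt c (drop i w)) else 0)"
  show "(if k \<in> set w then qpow (e * hgt (into k c) w) else 0) = (\<Sum>i\<le>length w. ?s i)"
  proof (cases "k \<in> set w")
    case True
    then obtain u v where uv: "w = u @ k # v" by (meson split_list)
    have "?s i = (if i = length u then qpow (e * hgt (into k c) w) else 0)" if "i \<le> length w" for i
    proof (cases "i = length u")
      case True
      then show ?thesis
        using w by (auto simp: uv hgt_into qpow_mult algebra_simps)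
    next
      case False
      have "drop i w = [] \<or> hd (drop i w) \<noteq> k"
      proof (cases "i < length w")
        case True
        have "w ! length u = k" by (simp add: uv)
        then have "w ! i \<noteq> k"
          using w True False by (metis length_append length_Cons less_add_Suc1 add_Suc_right nth_eq_iff_index_eq uv)
        then show ?thesis using True by (simp add: hd_drop_conv_nth)
      qed simp
      with False show ?thesis by auto
    qed
    then have "(\<Sum>i\<le>length w. ?s i)
      = (\<Sum>i\<le>length w. if i = length u then qpow (e * hgt (into k c) w) else 0)"
      by (intro sum.cong) auto
    also have "\<dots> = qpow (e * hgt (into k c) w)"
      by (simp add: uv)
    finally show ?thesis using True by simp
  next
    case False
    then have "\<not> (drop i w \<noteq> [] \<and> hd (drop i w) = k)" for i
      by (metis in_set_dropD list.set_sel(1))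
    then have "?s i = 0" for i by (simp only: if_False mult_zero_right)
    then have "(\<Sum>i\<le>length w. ?s i) = 0" by (intro sum.neutral ballI)
    with False show ?thesis by simp
  qed
qed

text \<open>Reversal turns the step into \<open>k\<close> into the step out of \<open>k\<close>, and
  the negated forced descent is the forced ascent. So the \<open>out_of\<close> case is the
  \<open>into\<close> case with 1/q in place of q.\<close>

lemma hgt_out_of_rev:
  assumes a: "antisym_step c" and w: "distinct w"
  shows "hgt (out_of k c) (rev w) = - hgt (into k c) w"
  using w
proof (induction w)
  case (Cons x w)
  show ?case
  proof (cases "w = []")
    case False
    then have "x \<noteq> hd w" using Cons.prems by auto
    then have "c (hd w) x = - c x (hd w)"
      using a unfolding antisym_step_def by blast
    with False Cons show ?thesis
      by (simp add: hgt_snoc hgt_Cons last_rev out_of_def into_def)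
  qed simp
qed simp

lemma word_sum_out_of:
  assumes "antisym_step c"
  shows "wsum_at k (\<lambda>w. qpow (hgt (out_of k c) w)) = wsum_at k (\<lambda>w. qpow (- hgt (into k c) w))"
  unfolding wsum_at_def
  by (subst wsum_rev[symmetric], rule wsum_cong) (simp add: hgt_out_of_rev[OF assms])

lemma unit_step_into: "unit_step c \<Longrightarrow> unit_step (into k c)"
  and unit_step_out_of: "unit_step c \<Longrightarrow> unit_step (out_of k c)"
  by (auto simp: unit_step_def into_def out_of_def)

lemma marked_product:
  assumes c: "unit_step c" and a: "antisym_step c"
  defines "\<beta> \<equiv> wsum (bal_wt c)" and "\<rho> \<equiv> wsum (rbal_wt c)"
  shows "\<rho> * (wsum_at k (bal_wt (into k c)) + wsum_at k (bal_wt (out_of k c)))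
       + (wsum_at k (rbal_wt (into k c)) + wsum_at k (rbal_wt (out_of k c))) * \<beta>
    = (const (qpow (- 1)) * (head_sum k c 1 + signed_head_sum k c 1)
       + const (qpow 1) * (head_sum k c (- 1) + signed_head_sum k c (- 1))) * (\<rho> * \<beta>)"
proof -
  define u v :: "('a, int \<Rightarrow>\<^sub>0 int) setfun" where "u = const (qpow 1)" and "v = const (qpow (- 1))"
  define W where "W = ne_sum c"
  define D E where "D = head_sum k c 1" and "E = head_sum k c (- 1)"
  define Ds Es where "Ds = signed_head_sum k c 1" and "Es = signed_head_sum k c (- 1)"
  have F: "\<rho> * \<beta> = 1 + (u + v) * W"
    using rbal_times_bal[OF c] by (simp add: \<rho>_def \<beta>_def word_sum_eq u_def v_def W_def const_add)
  have DE: "\<rho> * \<beta> * Ds = E" "\<rho> * \<beta> * Es = D"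
    using word_sum_times_signed_head_sum[OF c a, of 1 k] word_sum_times_signed_head_sum[OF c a, of "- 1" k]
    by (simp_all add: rbal_times_bal[OF c] \<rho>_def \<beta>_def D_def E_def Ds_def Es_def)
  have at: "wsum_at k (word_wt c') = (u + v) * wsum_at k (\<lambda>w. qpow (hgt c' w))" for c'
    unfolding wsum_at_def u_def v_def const_add[symmetric] const_mult_wsum
    by (rule wsum_cong) (auto simp: word_wt_def)
  have I: "wsum_at k (\<lambda>w. qpow (hgt (into k c) w)) = (1 + v * W) * D"
  proof -
    have "wsum (\<lambda>w. if w = [] then 1 else qpow (1 * hgt c w - 1)) = 1 + v * W"
      unfolding W_def ne_sum_def v_def const_mult_wsum wsum_one[symmetric] wsum_add
      by (rule wsum_cong) (simp add: qpow_mult)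
    then show ?thesis
      using word_sum_into[of k 1 c] by (simp add: D_def)
  qed
  have O: "wsum_at k (\<lambda>w. qpow (hgt (out_of k c) w)) = (1 + u * W) * E"
  proof -
    have "wsum (\<lambda>w. if w = [] then 1 else qpow (- 1 * hgt c w - (- 1))) = 1 + u * W"
      unfolding W_def ne_sum_rev[OF a] u_def const_mult_wsum wsum_one[symmetric] wsum_add
      by (rule wsum_cong) (simp add: qpow_mult)
    then show ?thesis
      using word_sum_into[of k "- 1" c] by (simp add: E_def word_sum_out_of[OF a])
  qed
  have "\<rho> * wsum_at k (bal_wt (into k c)) + wsum_at k (rbal_wt (into k c)) * \<beta> = (u + v) * ((1 + v * W) * D)"
    using rbal_times_bal_at[OF unit_step_into[OF c], of k k c]
    by (simp add: \<rho>_def \<beta>_def at I into_def)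
  moreover have "\<rho> * wsum_at k (bal_wt (out_of k c)) + wsum_at k (rbal_wt (out_of k c)) * \<beta> = (u + v) * ((1 + u * W) * E)"
    using rbal_times_bal_at[OF unit_step_out_of[OF c], of k k c]
    by (simp add: \<rho>_def \<beta>_def at O out_of_def)
  ultimately have "\<rho> * (wsum_at k (bal_wt (into k c)) + wsum_at k (bal_wt (out_of k c)))
       + (wsum_at k (rbal_wt (into k c)) + wsum_at k (rbal_wt (out_of k c))) * \<beta>
     = (u + v) * ((1 + v * W) * D) + (u + v) * ((1 + u * W) * E)"
    by (simp add: algebra_simps)
  \<comment> \<open>The term (u + v)(1 + vW) D exceeds vD times \<open>1 + (u + v) * W\<close> by
    exactly uD, and the term with E exceeds uE times it by vE. The remainders become multiples of
    \<rho> * \<beta> through the signed sums in \<open>DE\<close>.\<close>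
  also have "\<dots> = (v * D + u * E) * (1 + (u + v) * W) + v * E + u * D"
    by (simp add: algebra_simps)
  also have "\<dots> = (v * D + u * E) * (\<rho> * \<beta>) + v * (\<rho> * \<beta> * Ds) + u * (\<rho> * \<beta> * Es)"
    by (simp only: F[symmetric] DE add.assoc)
  also have "\<dots> = (v * (D + Ds) + u * (E + Es)) * (\<rho> * \<beta>)"
    by (simp add: algebra_simps)
  finally show ?thesis by (simp add: u_def v_def D_def E_def Ds_def Es_def)
qed

section \<open>Extracting the part with positive exponents\<close>

definition keys_in :: "int set \<Rightarrow> ('b, int \<Rightarrow>\<^sub>0 int) setfun \<Rightarrow> bool" where
  "keys_in Z f \<longleftrightarrow> (\<forall>S. Poly_Mapping.keys (value_at f S) \<subseteq> Z)"

lemma keys_in_wsum: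
  assumes "\<And>w. distinct w \<Longrightarrow> Poly_Mapping.keys (\<phi> w) \<subseteq> Z"
  shows "keys_in Z (wsum \<phi>)"
  unfolding keys_in_def value_at_wsum
  by (intro allI order_trans[OF keys_sum] UN_least assms) (simp add: permutations_of_set_def)

lemma keys_in_add: "keys_in Z f \<Longrightarrow> keys_in Z g \<Longrightarrow> keys_in Z (f + g)"
  unfolding keys_in_def value_at_add by (intro allI order_trans[OF keys_add] Un_least) simp_all

lemma keys_in_diff: "keys_in Z f \<Longrightarrow> keys_in Z g \<Longrightarrow> keys_in Z (f - g)"
  unfolding keys_in_def value_at_diff by (intro allI order_trans[OF keys_diff] Un_least) simp_all

lemma keys_in_mult:
  assumes f: "keys_in Z f" and g: "keys_in Z' g"
    and Z: "\<And>a b. a \<in> Z \<Longrightarrow> b \<in> Z' \<Longrightarrow> a + b \<in> Z''"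
  shows "keys_in Z'' (f * g)"
proof -
  have "Poly_Mapping.keys (value_at f A * value_at g B) \<subseteq> Z''" for A B
  proof
    fix z assume "z \<in> Poly_Mapping.keys (value_at f A * value_at g B)"
    then obtain a b where "z = a + b" "a \<in> Poly_Mapping.keys (value_at f A)" "b \<in> Poly_Mapping.keys (value_at g B)"
      using keys_mult by blast
    with f g Z show "z \<in> Z''" unfolding keys_in_def by blast
  qed
  then show ?thesis
    unfolding keys_in_def value_at_mult by (intro allI order_trans[OF keys_sum] UN_least)
qed

text \<open>Every splitting with a proper first block vanishes, and the remaining one is multiplied
  by the constant term 1. This is the extraction of a leading value when induction runs over
  subsets.\<close>

lemma value_at_mult_unit:
  assumes "value_at g {} = 1" and "\<And>A. A \<subset> S \<Longrightarrow> value_at f A = 0"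
  shows "value_at (f * g) S = value_at f S"
proof (cases "finite S")
  case True
  have "value_at (f * g) S = (\<Sum>A\<in>Pow S. if A = S then value_at f S else 0)"
    unfolding value_at_mult using assms by (intro sum.cong) auto
  then show ?thesis using True by simp
qed simp

text \<open>By induction on the set, \<open>P\<close> and \<open>Q\<close> vanish on all proper
  subsets, so the equation at \<open>S\<close> reduces to P(S) + Q(S) = 0. One summand has only
  positive and the other only negative exponents, so both are 0.\<close>

lemma opposite_keys_zero:
  assumes P: "keys_in {0<..} P" and Q: "keys_in {..<0} Q"
    and units: "value_at f {} = 1" "value_at g {} = 1"
    and eq: "P * f + Q * g = 0"
  shows "P = 0"
proof -
  have "value_at P S = 0 \<and> value_at Q S = 0" if "finite S" for S
    using that
  proof (induction S rule: finite_psubset_induct)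
    case (psubset S)
    then have "value_at P S + value_at Q S = value_at (P * f + Q * g) S"
      unfolding value_at_add by (subst (1 2) value_at_mult_unit) (auto intro: units finite_subset)
    also have "\<dots> = 0" by (simp add: eq zero_setfun.rep_eq)
    finally have "value_at P S = - value_at Q S" by (simp add: eq_neg_iff_add_eq_0)
    moreover from this have "Poly_Mapping.keys (value_at P S) = Poly_Mapping.keys (value_at Q S)"
      by simp
    moreover have "Poly_Mapping.keys (value_at P S) \<subseteq> {0<..}" "Poly_Mapping.keys (value_at Q S) \<subseteq> {..<0}"
      using P Q by (auto simp: keys_in_def)
    then have "Poly_Mapping.keys (value_at P S) \<inter> Poly_Mapping.keys (value_at Q S) = {}"
      by fastforce
    ultimately show ?case by simp
  qed
  then show ?thesis by (intro setfun_eqI) (simp add: zero_setfun.rep_eq)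
qed

lemma even_hgt_length:
  assumes "unit_step c"
  shows "w \<noteq> [] \<Longrightarrow> even (hgt c w) \<longleftrightarrow> odd (length w)"
proof (induction w)
  case (Cons a w)
  then show ?case
    using unit_stepD[OF assms, of a "hd w"] by (cases "w = []") (auto simp: hgt_Cons)
qed simp

text \<open>A cycle through \<open>k\<close> is read from \<open>k\<close>, and the step closing it
  is counted as a descent whatever its last letter is; this is the true step when \<open>k\<close>
  is the smallest letter. The empty word, whose head is unspecified, is excluded by the odd
  length.\<close>

definition odd_cycle_sum :: "'b \<Rightarrow> ('b \<Rightarrow> 'b \<Rightarrow> int) \<Rightarrow> int \<Rightarrow> ('b, int \<Rightarrow>\<^sub>0 int) setfun" where
  "odd_cycle_sum k c e =
    wsum (\<lambda>w. if hd w = k \<and> odd (length w) then qpow (e * \<bar>hgt c w - 1\<bar>) else 0)"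

text \<open>The sign is 1 on words of odd length, where the signed sum doubles the unsigned one, and
  -1 on words of even length, where it cancels it. A pair of exponents x, -x is then rewritten as
  the pair with absolute values, so that the two summands on the right have exponents of opposite
  signs.\<close>

lemma signed_sums_eq_odd_cycle_sums:
  "const (qpow (- 1)) * (head_sum k c 1 + signed_head_sum k c 1)
     + const (qpow 1) * (head_sum k c (- 1) + signed_head_sum k c (- 1))
   = const 2 * (odd_cycle_sum k c 1 + odd_cycle_sum k c (- 1))"
  unfolding head_sum_def signed_head_sum_def odd_cycle_sum_def wsum_add const_mult_wsum
proof (rule wsum_cong)
  fix w :: "'a list"
  let ?a = "\<lambda>e. if w \<noteq> [] \<and> hd w = k then qpow (e * hgt c w) else 0"
  let ?b = "\<lambda>e. if w \<noteq> [] \<and> hd w = k then (- 1) ^ (length w - 1) * qpow (e * hgt c w) else 0"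
  let ?c = "\<lambda>e. if hd w = k \<and> odd (length w) then qpow (e * \<bar>hgt c w - 1\<bar>) else 0"
  have abs: "qpow (1 * \<bar>x\<bar>) + qpow (- 1 * \<bar>x\<bar>) = qpow x + qpow (- x)" for x
    by (cases "0 \<le> x") (simp_all add: add.commute)
  show "qpow (- 1) * (?a 1 + ?b 1) + qpow 1 * (?a (- 1) + ?b (- 1)) = 2 * (?c 1 + ?c (- 1))"
  proof (cases "hd w = k \<and> w \<noteq> []")
    case True
    then have a: "?a e = qpow (e * hgt c w)" for e by simp
    show ?thesis
    proof (cases "odd (length w)")
      case odd: True
      then have "even (length w - 1)" by simp
      then have b: "?b e = qpow (e * hgt c w)" for e using True by simp
      have c: "?c e = qpow (e * \<bar>hgt c w - 1\<bar>)" for e using True odd by simp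
      have "qpow (- 1) * (qpow (1 * hgt c w) + qpow (1 * hgt c w))
          + qpow 1 * (qpow (- 1 * hgt c w) + qpow (- 1 * hgt c w))
        = 2 * (qpow (hgt c w - 1) + qpow (- (hgt c w - 1)))"
      proof -
        have "qpow (- 1) * qpow (1 * hgt c w) = qpow (hgt c w - 1)"
          "qpow 1 * qpow (- 1 * hgt c w) = qpow (- (hgt c w - 1))"
          by (simp_all add: qpow_mult)
        then show ?thesis
          by (simp only: distrib_left mult_2 add_ac)
      qed
      then show ?thesis unfolding a b c abs .
    next
      case False
      then have "odd (length w - 1)" using True by (cases w) auto
      then have b: "?b e = - qpow (e * hgt c w)" for e using True by simp
      have c: "?c e = 0" for e using False by simp
      show ?thesis unfolding a b c by simp
    qed
  next
    case False
    then have "?a e = 0" "?b e = 0" "?c e = 0" for e by auto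
    then show ?thesis by (simp only: mult_zero_right add_0_right)
  qed
qed

text \<open>Since \<^term>\<open>hgt c w\<close> is even for words of odd length, no exponent \<open>hgt c w - 1\<close> is 0 and the
  right-hand side of \<open>marked_product\<close> splits into positive and negative exponents.\<close>

theorem marked_bal_sum:
  assumes c: "unit_step c" and a: "antisym_step c"
  shows "wsum_at k (bal_wt (into k c)) + wsum_at k (bal_wt (out_of k c))
    = const 2 * odd_cycle_sum k c 1 * wsum (bal_wt c)" (is "?T = const 2 * ?K * ?\<beta>")
proof -
  define T' where "T' = wsum_at k (rbal_wt (into k c)) + wsum_at k (rbal_wt (out_of k c))"
  define K' where "K' = odd_cycle_sum k c (- 1)"
  let ?\<rho> = "wsum (rbal_wt c)"
  \<comment> \<open>\<open>P\<close> measures the failure of the claim and \<open>Q\<close> that of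
    its mirror image for reverse ballot words; \<open>marked_product\<close> states that P * \<rho>
    + Q * \<beta> = 0.\<close>
  define P where "P = ?T - const 2 * ?K * ?\<beta>"
  define Q where "Q = T' - const 2 * K' * ?\<rho>"
  have K: "keys_in {0<..} ?K" "keys_in {..<0} K'"
  proof -
    have "hgt c w \<noteq> 1" if "odd (length w)" for w :: "'a list"
      using even_hgt_length[OF c, of w] that by (cases "w = []") auto
    then show "keys_in {0<..} ?K" "keys_in {..<0} K'"
      unfolding odd_cycle_sum_def K'_def by (auto intro!: keys_in_wsum simp: qpow_def split: if_splits)
  qed
  have two: "keys_in {0} (const 2 :: ('a, int \<Rightarrow>\<^sub>0 int) setfun)"
    unfolding keys_in_def const.rep_eq
    by (simp flip: single_numeral)
  have bal: "0 \<le> hgt c' w" if "bal c' w" for c' :: "'a \<Rightarrow> 'a \<Rightarrow> int" and w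
    using that unfolding bal_def by (metis order_refl take_all)
  have rbal: "hgt c' w \<le> 0" if "rbal c' w" for c' :: "'a \<Rightarrow> 'a \<Rightarrow> int" and w
    using that unfolding rbal_def by (metis drop_0 le0)
  have bal_keys: "Poly_Mapping.keys (bal_wt c' w) \<subseteq> (if w = [] then {0} else {0<..})"
    and rbal_keys: "Poly_Mapping.keys (rbal_wt c' w) \<subseteq> (if w = [] then {0} else {..<0})"
    for c' :: "'a \<Rightarrow> 'a \<Rightarrow> int" and w
    using bal[of c' w] rbal[of c' w] by (auto simp: bal_wt_def rbal_wt_def qpow_def)
  have B: "keys_in {0..} ?\<beta>"
    by (intro keys_in_wsum order_trans[OF bal_keys]) auto
  have R: "keys_in {..0} ?\<rho>"
    by (intro keys_in_wsum order_trans[OF rbal_keys]) auto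
  have Bk: "keys_in {0<..} (wsum_at k (bal_wt c'))" for c'
    unfolding wsum_at_def by (intro keys_in_wsum) (auto dest!: subsetD[OF bal_keys] split: if_splits)
  have Rk: "keys_in {..<0} (wsum_at k (rbal_wt c'))" for c'
    unfolding wsum_at_def by (intro keys_in_wsum) (auto dest!: subsetD[OF rbal_keys] split: if_splits)
  have "keys_in {0<..} P"
    unfolding P_def
    by (intro keys_in_diff keys_in_add Bk keys_in_mult[OF keys_in_mult[OF two K(1)] B]) auto
  moreover have "keys_in {..<0} Q"
    unfolding Q_def T'_def
    by (intro keys_in_diff keys_in_add Rk keys_in_mult[OF keys_in_mult[OF two K(2)] R]) auto
  moreover have "P * ?\<rho> + Q * ?\<beta> = 0"
    using marked_product[OF c a, of k]
    unfolding signed_sums_eq_odd_cycle_sums T'_def[symmetric] K'_def[symmetric] P_def Q_def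
    by (simp add: algebra_simps)
  moreover have "value_at ?\<rho> {} = 1" "value_at ?\<beta> {} = 1"
    by (simp_all add: value_at_wsum bal_wt_def rbal_wt_def)
  ultimately have "P = 0" using opposite_keys_zero by blast
  then show ?thesis by (simp add: P_def)
qed

section \<open>Odd order permutations\<close>

text \<open>Ties count as ascents, as in \<^const>\<open>casc\<close> for cycles of length 1.\<close>

definition step :: "nat \<Rightarrow> nat \<Rightarrow> int" where
  "step a b = (if b < a then - 1 else 1)"

lemma unit_step_step: "unit_step step" and antisym_step_step: "antisym_step step"
  by (auto simp: unit_step_def antisym_step_def step_def)

lemma des_Cons:
  assumes "w \<noteq> []"
  shows "des (a # w) = (if hd w < a then 1 else 0) + des w"
proof -
  let ?D = "{i. Suc i < length w \<and> w ! i > w ! Suc i}"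
  have "{i. Suc i < length (a # w) \<and> (a # w) ! i > (a # w) ! Suc i}
      = (if hd w < a then {0} else {}) \<union> Suc ` ?D" (is "?L = ?R")
  proof (rule set_eqI)
    fix i
    show "i \<in> ?L \<longleftrightarrow> i \<in> ?R"
      using assms by (cases i) (auto simp: hd_conv_nth)
  qed
  moreover have "finite ?D" by (rule finite_subset[of _ "{..<length w}"]) auto
  ultimately show ?thesis
    by (auto simp: des_def card_insert_if card_image)
qed

lemma hgt_step_des: "w \<noteq> [] \<Longrightarrow> hgt step w = int (length w) - 1 - 2 * int (des w)"
proof (induction w)
  case (Cons a w)
  then show ?case
    by (cases "w = []") (auto simp: hgt_Cons des_Cons step_def, simp add: des_def)
qed simp

lemma cdes_eq_des:
  assumes "v \<noteq> []"
  shows "cdes v = des (v @ [hd v])"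
proof -
  have "(v @ [hd v]) ! Suc i = v ! (Suc i mod length v)" if "i < length v" for i
    using that assms by (cases "Suc i = length v") (auto simp: nth_append hd_conv_nth)
  moreover have "(v @ [hd v]) ! i = v ! i" if "i < length v" for i
    using that by (simp add: nth_append)
  ultimately have "{i. i < length v \<and> v ! i > v ! (Suc i mod length v)}
    = {i. Suc i < length (v @ [hd v]) \<and> (v @ [hd v]) ! i > (v @ [hd v]) ! Suc i}"
    by auto
  then show ?thesis by (simp add: cdes_def des_def)
qed

lemma cdes_le_length: "cdes v \<le> length v"
  unfolding cdes_def by (rule order_trans[OF card_mono[of "{..<length v}"]]) auto

text \<open>Both sides are the absolute difference of cyclic ascents and cyclic descents: in a word
  starting with its smallest letter the step that closes the cycle is a descent.\<close>

lemma cycle_stat: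
  assumes "distinct v" and "v \<noteq> []" and min: "hd v = Min (set v)"
  shows "int (length v) - 2 * int (min (cdes v) (casc v)) = \<bar>hgt step v - 1\<bar>"
proof -
  have "int (length v) - 2 * int (min (cdes v) (casc v)) = \<bar>int (length v) - 2 * int (cdes v)\<bar>"
    using cdes_le_length[of v] by (auto simp: casc_def min_def)
  also have "int (length v) - 2 * int (cdes v) = hgt step (v @ [hd v])"
    using assms by (simp add: cdes_eq_des hgt_step_des)
  also have "\<dots> = hgt step v + step (last v) (hd v)"
    using assms by (simp add: hgt_snoc)
  also have "\<bar>\<dots>\<bar> = \<bar>hgt step v - 1\<bar>"
  proof (cases "tl v = []")
    \<comment> \<open>A fixed point closes with a tie, which \<open>step\<close> counts as +1; from
      height 0 this has the same absolute value as -1.\<close>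
    case True
    then obtain a where "v = [a]" using assms by (cases v) auto
    then show ?thesis by (simp add: step_def)
  next
    case False
    then have "last v \<in> set (tl v)" by (cases v) auto
    then have "last v \<noteq> hd v" using assms by (cases v) auto
    moreover have "hd v \<le> last v" using assms by simp
    ultimately show ?thesis by (simp add: step_def)
  qed
  finally show ?thesis .
qed

section \<open>Cycles of permutations of an arbitrary finite set of letters\<close>

definition cyc_word :: "nat set \<Rightarrow> (nat \<Rightarrow> nat) \<Rightarrow> nat list \<Rightarrow> bool" where
  "cyc_word S p v \<longleftrightarrow> v \<noteq> [] \<and> distinct v \<and> set v \<subseteq> S \<and> map p v = rotate1 v"

definition cycs :: "nat set \<Rightarrow> (nat \<Rightarrow> nat) \<Rightarrow> nat list set" where
  "cycs S p = {v. cyc_word S p v \<and> hd v = Min (set v)}"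

definition odd_perms :: "nat set \<Rightarrow> (nat \<Rightarrow> nat) set" where
  "odd_perms S = {p. p permutes S \<and> (\<forall>c\<in>cycs S p. odd (length c))}"

definition cyc_stat :: "nat set \<Rightarrow> (nat \<Rightarrow> nat) \<Rightarrow> nat" where
  "cyc_stat S p = (\<Sum>c\<in>cycs S p. min (cdes c) (casc c))"

text \<open>The exponent mirrors \<open>length w - 2 * des w\<close>, the exponent in
  \<open>bal_wt step\<close>. Arbitrary sets of letters are needed because removing a cycle from an
  interval need not leave an interval.\<close>

definition odd_perm_sum :: "nat set \<Rightarrow> int \<Rightarrow>\<^sub>0 int" where
  "odd_perm_sum T = (\<Sum>q\<in>odd_perms T. qpow (int (card T) - 2 * int (cyc_stat T q)))"

lemma cyc_word_rotate: "cyc_word S p v \<Longrightarrow> cyc_word S p (rotate m v)"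
  unfolding cyc_word_def by (metis distinct_rotate rotate1_rotate_swap rotate_is_Nil_conv rotate_map set_rotate)

lemma cyc_word_funpow:
  assumes "cyc_word S p v" and "i < length v"
  shows "v ! i = (p ^^ i) (hd v)"
  using assms(2)
proof (induction i)
  case 0
  then show ?case using assms by (simp add: cyc_word_def hd_conv_nth)
next
  case (Suc i)
  have "p (v ! i) = rotate1 v ! i"
    using assms(1) Suc.prems by (metis Suc_lessD cyc_word_def nth_map)
  with Suc show ?case by (simp add: nth_rotate1)
qed

lemma cyc_word_funpow_length:
  assumes "cyc_word S p v"
  shows "(p ^^ length v) (hd v) = hd v"
proof -
  obtain n where n: "length v = Suc n" using assms by (cases v) (auto simp: cyc_word_def)
  have "p (v ! n) = rotate1 v ! n"
    using assms n by (metis cyc_word_def lessI nth_map)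
  then show ?thesis
    using cyc_word_funpow[OF assms, of n] cyc_word_funpow[OF assms, of 0] n assms
    by (simp add: nth_rotate1)
qed

text \<open>Both words list the orbit of the same letter, so a longer \<open>w\<close> would repeat
  its head at position \<open>length v\<close>.\<close>

lemma cyc_word_length_le:
  assumes "cyc_word S p v" and "cyc_word S p w" and "hd v = hd w"
  shows "length w \<le> length v"
proof (rule ccontr)
  assume less: "\<not> length w \<le> length v"
  then have "w ! length v = w ! 0"
    using cyc_word_funpow[OF assms(2), of "length v"] cyc_word_funpow_length[OF assms(1)] assms
    by (simp add: cyc_word_def hd_conv_nth)
  then show False
    using less assms by (simp add: cyc_word_def nth_eq_iff_index_eq)
qed

lemma cyc_word_unique:
  assumes "cyc_word S p v" and "cyc_word S p w" and "hd v = hd w"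
  shows "v = w"
proof (rule nth_equalityI)
  show "length v = length w"
    using cyc_word_length_le assms by (metis order_antisym)
  then show "v ! i = w ! i" if "i < length v" for i
    using that assms cyc_word_funpow by metis
qed

text \<open>Rotated to start at the common letter, the two words coincide.\<close>

lemma cyc_word_set_eq:
  assumes v: "cyc_word S p v" and w: "cyc_word S p w" and "x \<in> set v" and "x \<in> set w"
  shows "set v = set w"
proof -
  have ex: "\<exists>m. hd (rotate m u) = x" if "x \<in> set u" for u
    using that by (metis hd_rotate_conv_nth in_set_conv_nth length_pos_if_in_set less_nat_zero_code
        list.size(3) mod_less)
  obtain i j where "hd (rotate i v) = x" "hd (rotate j w) = x"
    using ex assms by metis
  then have "rotate i v = rotate j w"
    using cyc_word_unique cyc_word_rotate v w by metis
  then show ?thesis by (metis set_rotate)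
qed

lemma cycs_unique:
  assumes "v \<in> cycs S p" "w \<in> cycs S p" "x \<in> set v" "x \<in> set w"
  shows "v = w"
proof -
  have "set v = set w" using cyc_word_set_eq[of S p v w x] assms by (simp add: cycs_def)
  then show ?thesis using assms cyc_word_unique[of S p v w] by (simp add: cycs_def)
qed

lemma finite_cycs: "finite S \<Longrightarrow> finite (cycs S p)"
  by (rule finite_subset[OF _ finite_subset_distinct[of S]]) (auto simp: cycs_def cyc_word_def)

section \<open>Removing the cycle through the smallest letter\<close>

context
  fixes S :: "nat set" and k :: nat
  assumes S: "finite S" and k: "k \<in> S" "k = Min S"
begin

lemma cyc_word_support:
  assumes "q permutes S"
  shows "cyc_word S q (support q k)" and "hd (support q k) = k"
proof -
  have q: "permutation q" using assms S by (auto simp: permutation_permutes)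
  note l = least_power_of_permutation[OF q, of k]
  have "(q ^^ i) k \<in> S" for i
    using permutes_in_image[OF permutes_funpow[OF assms]] k by simp
  moreover have "map q (support q k) = rotate1 (support q k)"
  proof (rule nth_equalityI)
    fix i assume "i < length (map q (support q k))"
    then have i: "i < least_power q k" by simp
    show "map q (support q k) ! i = rotate1 (support q k) ! i"
    proof (cases "Suc i = least_power q k")
      case True
      then have "q ((q ^^ i) k) = k" using l(1) by (metis comp_apply funpow.simps(2))
      with True show ?thesis using i by (simp add: nth_rotate1)
    next
      case False
      with i have "Suc i < least_power q k" by simp
      then show ?thesis using i by (simp add: nth_rotate1)
    qed
  qed simp
  ultimately show "cyc_word S q (support q k)"
    using cycle_of_permutation[OF q, of k] l by (auto simp: cyc_word_def)
  show "hd (support q k) = k" using l by (simp add: hd_map)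
qed

context
  fixes v :: "nat list" and p :: "nat \<Rightarrow> nat"
  assumes v: "distinct v" "v \<noteq> []" "hd v = k" "set v \<subseteq> S"
    and p: "p permutes S - set v"
begin

lemma glue_simps:
  "x \<in> set v \<Longrightarrow> (p \<circ> cycle_of_list v) x = cycle_of_list v x"
  "x \<notin> set v \<Longrightarrow> (p \<circ> cycle_of_list v) x = p x"
  using p permutes_in_image[OF cycle_permutes[of v], of x]
  by (auto simp: id_outside_supp intro!: permutes_not_in[of p])

lemma glue_permutes: "p \<circ> cycle_of_list v permutes S"
  using permutes_compose[OF permutes_subset[OF cycle_permutes v(4)] permutes_subset[OF p]] by auto

lemma glue_cyc_word: "cyc_word S (p \<circ> cycle_of_list v) v"
proof -
  have "map (cycle_of_list v) v = rotate1 v"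
    using cyclic_rotation[OF v(1), of 1] by simp
  moreover have "map (p \<circ> cycle_of_list v) v = map (cycle_of_list v) v"
    by (rule map_cong) (simp_all only: glue_simps)
  ultimately show ?thesis using v by (simp add: cyc_word_def)
qed

text \<open>A cycle word is determined by its head, so the cycle read off at \<open>k\<close> is the
  one glued in. This makes the decomposition below injective.\<close>

lemma glue_support: "support (p \<circ> cycle_of_list v) k = v"
  using cyc_word_unique[OF cyc_word_support(1)[OF glue_permutes] glue_cyc_word]
    cyc_word_support(2)[OF glue_permutes] v by simp

lemma hd_eq_Min: "hd v = Min (set v)"
proof (rule Min_eqI[symmetric])
  show "hd v \<in> set v" using v(2) by simp
  show "hd v \<le> x" if "x \<in> set v" for x
    using that v k S by auto
qed simp

text \<open>A cycle that meets \<open>v\<close> is \<open>v\<close> itself by uniqueness, and away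
  from \<open>v\<close> the glued permutation acts as \<open>p\<close>.\<close>

lemma cycs_glue: "cycs S (p \<circ> cycle_of_list v) = insert v (cycs (S - set v) p)"
proof (intro equalityI subsetI)
  fix w assume w: "w \<in> cycs S (p \<circ> cycle_of_list v)"
  show "w \<in> insert v (cycs (S - set v) p)"
  proof (cases "set w \<inter> set v = {}")
    case True
    then have "map (p \<circ> cycle_of_list v) w = map p w"
      by (intro map_cong[OF refl] glue_simps(2)) blast
    with w True show ?thesis by (auto simp: cycs_def cyc_word_def)
  next
    case False
    moreover have "v \<in> cycs S (p \<circ> cycle_of_list v)"
      using glue_cyc_word hd_eq_Min by (simp add: cycs_def)
    ultimately show ?thesis using w cycs_unique by blast
  qed
next
  fix w assume "w \<in> insert v (cycs (S - set v) p)"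
  then consider "w = v" | "w \<in> cycs (S - set v) p" by blast
  then show "w \<in> cycs S (p \<circ> cycle_of_list v)"
  proof cases
    case 1
    then show ?thesis using glue_cyc_word hd_eq_Min by (simp add: cycs_def)
  next
    case 2
    then have "map (p \<circ> cycle_of_list v) w = map p w"
      by (intro map_cong[OF refl] glue_simps(2)) (auto simp: cycs_def cyc_word_def)
    with 2 show ?thesis by (auto simp: cycs_def cyc_word_def)
  qed
qed

lemma v_notin_cycs: "v \<notin> cycs (S - set v) p"
  using v by (cases v) (auto simp: cycs_def cyc_word_def)

lemma glue_odd: "p \<circ> cycle_of_list v \<in> odd_perms S \<longleftrightarrow> odd (length v) \<and> p \<in> odd_perms (S - set v)"
  using glue_permutes p by (auto simp: odd_perms_def cycs_glue)

text \<open>The exponent is additive over cycles: each contributes its length minus twice its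
  minimum, which \<open>cycle_stat\<close> turns into a height.\<close>

lemma glue_stat:
  "qpow (int (card S) - 2 * int (cyc_stat S (p \<circ> cycle_of_list v)))
    = qpow \<bar>hgt step v - 1\<bar> * qpow (int (card (S - set v)) - 2 * int (cyc_stat (S - set v) p))"
proof -
  have "cyc_stat S (p \<circ> cycle_of_list v) = min (cdes v) (casc v) + cyc_stat (S - set v) p"
    unfolding cyc_stat_def cycs_glue using v_notin_cycs finite_cycs S by simp
  moreover have "int (card S) = int (length v) + int (card (S - set v))"
    using S v card_Diff_subset[of "set v" S] card_mono[of S "set v"] by (simp add: distinct_card)
  ultimately show ?thesis
    using cycle_stat[OF v(1,2) hd_eq_Min] by (simp add: qpow_mult algebra_simps)
qed

end

text \<open>A permutation corresponds to its cycle through \<open>k\<close>, read from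
  \<open>k\<close>, together with a permutation of the remaining letters. The letter set
  \<open>A\<close> of the cycle is summed over separately to give the shape of a product of set
  functions.\<close>

lemma sum_permutes_by_cycle:
  "(\<Sum>q\<in>{q. q permutes S}. f (support q k) q)
    = (\<Sum>A\<in>Pow S. \<Sum>v\<in>{v\<in>permutations_of_set A. v \<noteq> [] \<and> hd v = k}.
        \<Sum>p\<in>{p. p permutes S - A}. f v (p \<circ> cycle_of_list v))"
proof -
  let ?V = "\<lambda>A. {v\<in>permutations_of_set A. v \<noteq> [] \<and> hd v = k}"
  let ?X = "SIGMA A:Pow S. SIGMA v:?V A. {p. p permutes S - A}"
  \<comment> \<open>The given permutation with all points of the cycle through \<open>k\<close> made
    fixed.\<close>
  let ?rest = "\<lambda>q x. if x \<in> set (support q k) then x else q x"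
  have "(\<Sum>q\<in>{q. q permutes S}. f (support q k) q)
      = (\<Sum>(A, v, p)\<in>?X. f v (p \<circ> cycle_of_list v))"
  proof (rule sum.reindex_bij_witness[of _ "\<lambda>(A, v, p). p \<circ> cycle_of_list v"
        "\<lambda>q. (set (support q k), support q k, ?rest q)"])
    fix q assume "q \<in> {q. q permutes S}"
    then have q: "q permutes S" by simp
    let ?v = "support q k"
    note cw = cyc_word_support[OF q]
    have v: "distinct ?v" "?v \<noteq> []" "set ?v \<subseteq> S" "map q ?v = rotate1 ?v"
      using cw(1) unfolding cyc_word_def by blast+
    have cq: "cycle_of_list ?v x = q x" if "x \<in> set ?v" for x
    proof -
      have "map (cycle_of_list ?v) ?v = map q ?v"
        using cyclic_rotation[OF v(1), of 1] v(4) by simp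
      then show ?thesis using that by (simp only: map_eq_conv)
    qed
    have img: "q ` set ?v = set ?v"
      using v(4) by (metis list.set_map set_rotate1)
    show glue: "(case (set ?v, ?v, ?rest q) of (A, v, p) \<Rightarrow> p \<circ> cycle_of_list v) = q"
    proof
      fix x
      show "(case (set ?v, ?v, ?rest q) of (A, v, p) \<Rightarrow> p \<circ> cycle_of_list v) x = q x"
      proof (cases "x \<in> set ?v")
        case True
        then have "q x \<in> set ?v" using img by blast
        with True show ?thesis using cq[OF True] by (simp only: case_prod_conv comp_apply if_True)
      next
        case False
        then show ?thesis by (simp only: case_prod_conv comp_apply id_outside_supp[OF False] if_False)
      qed
    qed
    have "bij_betw q (S - set ?v) (S - set ?v)"
      using q img v(3)
      by (metis bij_betw_DiffI bij_betw_subset permutes_imp_bij)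
    then have "bij_betw (?rest q) (S - set ?v) (S - set ?v)"
      by (rule bij_betw_cong[THEN iffD1, rotated]) simp
    then have "?rest q permutes S - set ?v"
      using q by (intro bij_imp_permutes) (auto simp: permutes_not_in)
    then show "(set ?v, ?v, ?rest q) \<in> ?X"
      using v cw(2) by (simp only: mem_Sigma_iff Pow_iff mem_Collect_eq permutations_of_set_def) simp
    show "(case (set ?v, ?v, ?rest q) of (A, v, p) \<Rightarrow> f v (p \<circ> cycle_of_list v)) = f ?v q"
      using glue by (simp only: case_prod_conv)
  next
    fix b assume "b \<in> ?X"
    then obtain v p where b: "b = (set v, v, p)" "distinct v" "v \<noteq> []" "hd v = k" "set v \<subseteq> S"
      "p permutes S - set v"
      by (auto simp: permutations_of_set_def)
    show "(case b of (A, v, p) \<Rightarrow> p \<circ> cycle_of_list v) \<in> {q. q permutes S}"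
      using glue_permutes[OF b(2-6)] by (simp add: b(1))
    have "?rest (p \<circ> cycle_of_list v) = p"
      unfolding glue_support[OF b(2-6)] using b(6)
      by (auto simp: id_outside_supp permutes_not_in fun_eq_iff)
    then show "(set (support (case b of (A, v, p) \<Rightarrow> p \<circ> cycle_of_list v) k),
        support (case b of (A, v, p) \<Rightarrow> p \<circ> cycle_of_list v) k,
        ?rest (case b of (A, v, p) \<Rightarrow> p \<circ> cycle_of_list v)) = b"
      unfolding b(1) case_prod_conv glue_support[OF b(2-6)] by simp
  qed
  also have "\<dots> = (\<Sum>A\<in>Pow S. \<Sum>v\<in>?V A. \<Sum>p\<in>{p. p permutes S - A}. f v (p \<circ> cycle_of_list v))"
  proof -
    have "finite {p. p permutes S - A}" for A
      using S by (intro finite_permutations) simp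
    moreover from this have "finite (SIGMA v:?V A. {p. p permutes S - A})" for A
      by (intro finite_SigmaI) auto
    ultimately show ?thesis
      using S by (subst sum.Sigma[symmetric], simp, simp, subst sum.Sigma) auto
  qed
  finally show ?thesis .
qed

text \<open>The predicate \<open>R\<close> serves two purposes: constantly true, it yields the
  recursion for all odd order permutations; as a condition on the first three letters, it selects
  those with the prescribed cyclic factor.\<close>

lemma odd_perm_sum_by_cycle:
  "(\<Sum>q\<in>{q\<in>odd_perms S. R (support q k)}. qpow (int (card S) - 2 * int (cyc_stat S q)))
    = (\<Sum>A\<in>Pow S. (\<Sum>v\<in>permutations_of_set A.
        if hd v = k \<and> odd (length v) \<and> R v then qpow \<bar>hgt step v - 1\<bar> else 0) * odd_perm_sum (S - A))"
proof -
  let ?w = "\<lambda>T q. qpow (int (card T) - 2 * int (cyc_stat T q))"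
  have fin: "finite {q. q permutes T}" if "T \<subseteq> S" for T
    using S that by (intro finite_permutations) (auto intro: finite_subset)
  have "(\<Sum>q\<in>{q\<in>odd_perms S. R (support q k)}. ?w S q)
      = (\<Sum>q\<in>{q. q permutes S}. if q \<in> odd_perms S \<and> R (support q k) then ?w S q else 0)"
    using fin[of S] by (intro sum.mono_neutral_cong_left) (auto simp: odd_perms_def)
  also have "\<dots> = (\<Sum>A\<in>Pow S. \<Sum>v\<in>{v\<in>permutations_of_set A. v \<noteq> [] \<and> hd v = k}.
        \<Sum>p\<in>{p. p permutes S - A}.
          if p \<circ> cycle_of_list v \<in> odd_perms S \<and> R v then ?w S (p \<circ> cycle_of_list v) else 0)"
    by (rule sum_permutes_by_cycle)
  also have "\<dots> = (\<Sum>A\<in>Pow S. \<Sum>v\<in>{v\<in>permutations_of_set A. v \<noteq> [] \<and> hd v = k}.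
      (if odd (length v) \<and> R v then qpow \<bar>hgt step v - 1\<bar> else 0) * odd_perm_sum (S - A))"
  proof (intro sum.cong refl)
    fix A v assume A: "A \<in> Pow S" and "v \<in> {v\<in>permutations_of_set A. v \<noteq> [] \<and> hd v = k}"
    then have v: "distinct v" "v \<noteq> []" "hd v = k" "set v \<subseteq> S" and Av: "A = set v"
      by (auto simp: permutations_of_set_def)
    have "(\<Sum>p\<in>{p. p permutes S - A}.
          if p \<circ> cycle_of_list v \<in> odd_perms S \<and> R v then ?w S (p \<circ> cycle_of_list v) else 0)
      = (\<Sum>p\<in>{p. p permutes S - A}. if p \<in> odd_perms (S - A)
          then (if odd (length v) \<and> R v then qpow \<bar>hgt step v - 1\<bar> else 0) * ?w (S - A) p else 0)"
    proof (intro sum.cong refl)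
      fix p assume "p \<in> {p. p permutes S - A}"
      then have p: "p permutes S - set v" by (simp add: Av)
      show "(if p \<circ> cycle_of_list v \<in> odd_perms S \<and> R v then ?w S (p \<circ> cycle_of_list v) else 0)
        = (if p \<in> odd_perms (S - A)
          then (if odd (length v) \<and> R v then qpow \<bar>hgt step v - 1\<bar> else 0) * ?w (S - A) p else 0)"
        unfolding glue_odd[OF v p] glue_stat[OF v p] Av by simp
    qed
    also have "\<dots> = (\<Sum>p\<in>odd_perms (S - A).
        (if odd (length v) \<and> R v then qpow \<bar>hgt step v - 1\<bar> else 0) * ?w (S - A) p)"
      using fin[of "S - A"] by (intro sum.mono_neutral_cong_right) (auto simp: odd_perms_def)
    also have "\<dots> = (if odd (length v) \<and> R v then qpow \<bar>hgt step v - 1\<bar> else 0) * odd_perm_sum (S - A)"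
      by (simp only: odd_perm_sum_def sum_distrib_left)
    finally show "(\<Sum>p\<in>{p. p permutes S - A}.
          if p \<circ> cycle_of_list v \<in> odd_perms S \<and> R v then ?w S (p \<circ> cycle_of_list v) else 0) = \<dots>" .
  qed
  also have "\<dots> = (\<Sum>A\<in>Pow S. (\<Sum>v\<in>permutations_of_set A.
        if hd v = k \<and> odd (length v) \<and> R v then qpow \<bar>hgt step v - 1\<bar> else 0) * odd_perm_sum (S - A))"
    unfolding sum_distrib_right
    by (intro sum.cong[OF refl] sum.mono_neutral_cong_left) auto
  finally show ?thesis .
qed

end

text \<open>Every step into the smallest letter is a descent and every step out of it an ascent, so
  forcing these directions changes nothing.\<close>

lemma wsum_at_Min:
  assumes "finite S" and "S \<noteq> {}"
  shows "value_at (wsum_at (Min S) (bal_wt (into (Min S) step))) S = value_at (wsum (bal_wt step)) S"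
    and "value_at (wsum_at (Min S) (bal_wt (out_of (Min S) step))) S = value_at (wsum (bal_wt step)) S"
proof -
  have le: "Min S \<le> a" if "a \<in> S" for a
    using assms that by simp
  have eq: "into (Min S) step a b = step a b" "out_of (Min S) step a b = step a b"
    if "a \<in> S" "b \<in> S" "a \<noteq> b" for a b
    using that le[of a] le[of b] by (auto simp: into_def out_of_def step_def)
  have w: "bal_wt (into (Min S) step) w = bal_wt step w" "bal_wt (out_of (Min S) step) w = bal_wt step w"
    if "w \<in> permutations_of_set S" for w
    by (intro bal_wt_cong eq; simp add: permutations_of_setD[OF that])+
  have "Min S \<in> set w" if "w \<in> permutations_of_set S" for w
    using that assms by (simp add: permutations_of_set_def)
  with w show "value_at (wsum_at (Min S) (bal_wt (into (Min S) step))) S = value_at (wsum (bal_wt step)) S"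
    "value_at (wsum_at (Min S) (bal_wt (out_of (Min S) step))) S = value_at (wsum (bal_wt step)) S"
    by (auto simp: wsum_at_def value_at_wsum intro!: sum.cong)
qed

theorem odd_perm_sum_eq_bal_sum:
  "finite S \<Longrightarrow> odd_perm_sum S = value_at (wsum (bal_wt step)) S"
proof (induction S rule: finite_psubset_induct)
  case (psubset S)
  show ?case
  proof (cases "S = {}")
    case True
    have "cycs {} p = {}" for p by (auto simp: cycs_def cyc_word_def)
    then have "odd_perms {} = {id}" "cyc_stat {} id = 0"
      by (auto simp: odd_perms_def cyc_stat_def)
    then show ?thesis
      by (simp add: True odd_perm_sum_def value_at_wsum bal_wt_def qpow_0)
  next
    case False
    define k where "k = Min S"
    have k: "k \<in> S" using psubset.hyps False by (simp add: k_def)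
    let ?K = "odd_cycle_sum k step 1" and ?B = "wsum (bal_wt step)"
    \<comment> \<open>For the smallest letter both marked sums are the full ballot sum, which
      accounts for the factor 2 on the left.\<close>
    have "2 * value_at ?B S = value_at (const 2 * ?K * ?B) S"
      using wsum_at_Min[OF psubset.hyps False]
      by (simp add: marked_bal_sum[OF unit_step_step antisym_step_step, symmetric] value_at_add k_def)
    then have "value_at ?B S = value_at (?K * ?B) S"
      by (simp add: mult.assoc value_at_const_mult)
    also have "\<dots> = (\<Sum>A\<in>Pow S. value_at ?K A * odd_perm_sum (S - A))"
      unfolding value_at_mult
    proof (intro sum.cong refl)
      fix A assume A: "A \<in> Pow S"
      \<comment> \<open>The induction hypothesis does not reach the complement of the empty set,
        which is \<open>S\<close> itself; there the cycle factor is 0.\<close>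
      show "value_at ?K A * value_at ?B (S - A) = value_at ?K A * odd_perm_sum (S - A)"
      proof (cases "A = {}")
        case True
        then show ?thesis by (simp add: odd_cycle_sum_def value_at_wsum)
      next
        case False
        with A have "S - A \<subset> S" by auto
        with psubset.IH show ?thesis by simp
      qed
    qed
    also have "\<dots> = odd_perm_sum S"
      using odd_perm_sum_by_cycle[OF psubset.hyps k, of "\<lambda>_. True"]
      by (simp add: k_def odd_cycle_sum_def value_at_wsum odd_perm_sum_def cong: if_cong)
    finally show ?thesis by simp
  qed
qed

section \<open>Words with a marked factor\<close>

text \<open>Distinct letters exclude the ties, which \<open>step\<close> would count as ascents and
  \<open>asc\<close> would not.\<close>

lemma height_eq_hgt: "distinct w \<Longrightarrow> height w = hgt step w"
proof (cases "w = []")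
  case False
  assume w: "distinct w"
  let ?A = "{i. Suc i < length w \<and> w ! i < w ! Suc i}" and ?D = "{i. Suc i < length w \<and> w ! i > w ! Suc i}"
  have "w ! i < w ! Suc i \<or> w ! i > w ! Suc i" if "Suc i < length w" for i
    using w that by (simp add: nth_eq_iff_index_eq flip: neq_iff)
  then have "{..<length w - 1} = ?A \<union> ?D"
    by (fastforce simp: less_diff_conv)
  then have "card {..<length w - 1} = card (?A \<union> ?D)" by simp
  also have "\<dots> = asc w + des w"
    unfolding asc_def des_def by (intro card_Un_disjoint) (auto intro: finite_subset[of _ "{..<length w}"])
  finally have "asc w + des w = length w - 1" by simp
  then show ?thesis using hgt_step_des[OF False] False by (simp add: height_def) (cases w; simp)
qed (simp add: height_def asc_def des_def)

lemma bij_betw_one_line: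
  "bij_betw (one_line n) {p. p permutes {1..n}} (permutations_of_set {1..n})"
proof -
  have "inj_on (one_line n) {p. p permutes {1..n}}"
  proof (rule inj_onI, rule ext)
    fix p q x assume pq: "p \<in> {p. p permutes {1..n}}" "q \<in> {p. p permutes {1..n}}" "one_line n p = one_line n q"
    show "p x = q x"
    proof (cases "x \<in> {1..n}")
      case True
      then have "x \<in> set [1..<Suc n]" by auto
      with pq(3) show ?thesis unfolding one_line_def map_eq_conv by blast
    next
      case False
      with pq show ?thesis by (simp add: permutes_not_in)
    qed
  qed
  moreover have "one_line n ` {p. p permutes {1..n}} = permutations_of_set {1..n}"
  proof (rule card_subset_eq)
    show "one_line n ` {p. p permutes {1..n}} \<subseteq> permutations_of_set {1..n}"
    proof (intro image_subsetI permutations_of_setI)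
      fix p assume "p \<in> {p. p permutes {1..n}}"
      then have p: "p permutes {1..n}" by simp
      have "set [1..<Suc n] = {1..n}" by auto
      then show "set (one_line n p) = {1..n}" "distinct (one_line n p)"
        using permutes_image[OF p] permutes_inj_on[OF p]
        by (simp_all only: one_line_def set_map distinct_map distinct_upt simp_thms)
    qed
    show "card (one_line n ` {p. p permutes {1..n}}) = card (permutations_of_set {1..n})"
      by (subst card_image[OF calculation]) (simp add: card_permutations)
  qed simp
  ultimately show ?thesis by (simp add: bij_betw_def)
qed

lemma ballot_iff_bal:
  assumes "p permutes {1..n}"
  shows "ballot n p \<longleftrightarrow> bal step (one_line n p)"
proof -
  have "distinct (one_line n p)"
    using bij_betw_one_line[of n] assms by (auto simp: bij_betw_def permutations_of_set_def)
  then have h: "height (take i (one_line n p)) = hgt step (take i (one_line n p))" for i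
    by (simp add: height_eq_hgt)
  have l: "length (one_line n p) = n" by (simp add: one_line_def)
  have "(\<forall>i\<in>{1..n}. 0 \<le> hgt step (take i w)) \<longleftrightarrow> (\<forall>i\<le>n. 0 \<le> hgt step (take i w))" for w
    by (metis One_nat_def Suc_leI atLeastAtMost_iff bot_nat_0.not_eq_extremum hgt.simps(1) order_refl take0 take_0)
  then show ?thesis using assms by (simp add: ballot_def bal_def h l)
qed

lemma bal_snoc: "bal c (u @ [x]) \<longleftrightarrow> bal c u \<and> 0 \<le> hgt c (u @ [x])"
  by (auto simp: bal_def le_Suc_eq)

lemma hgt_out_of:
  assumes "distinct (u @ k # v)"
  shows "hgt (out_of k c) (u @ k # v) = hgt c (u @ [k]) + (if v = [] then 0 else 1) + hgt c v"
proof -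
  have uk: "hgt (out_of k c) (u @ [k]) = hgt c (u @ [k])"
  proof (cases "u = []")
    case False
    moreover have "hgt (out_of k c) u = hgt c u"
      using assms by (intro hgt_cong) (auto simp: out_of_def)
    moreover have "last u \<noteq> k" using assms False by auto
    ultimately show ?thesis by (simp add: hgt_snoc out_of_def)
  qed simp
  have v: "hgt (out_of k c) v = hgt c v"
    using assms by (intro hgt_cong) (auto simp: out_of_def)
  show ?thesis
  proof (cases "v = []")
    case False
    then show ?thesis
      using uk v hgt_append[of "u @ [k]" v "out_of k c"] by (simp add: out_of_def)
  qed (use uk in simp)
qed

section \<open>Inserting 1 and n next to the marked letter\<close>

context
  fixes n j :: nat
  assumes j: "1 < j" "j < n"
begin

text \<open>The steps into 1, n and \<open>j\<close> add up to -1 + 1 - 1, the single forced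
  descent. If \<open>u\<close> is empty the first of them is missing and the total is 0, as is the
  contribution before \<open>j\<close> on the right.\<close>

lemma hgt_insert_before:
  assumes "distinct (u @ j # v)" and "\<forall>x\<in>set (u @ v). 1 < x \<and> x < n"
  shows "hgt step (u @ 1 # n # j # v) = hgt (into j step) (u @ j # v)"
proof (cases "u = []")
  case True
  then show ?thesis using hgt_into[OF assms(1), of step] j by (simp add: step_def)
next
  case False
  then have "last u \<in> set (u @ v)" by simp
  then have "1 < last u" using assms(2) by blast
  then show ?thesis
    using False hgt_into[OF assms(1), of step] j by (simp add: hgt_append step_def)
qed

text \<open>The inserted letters create no new constraint: the prefix ending in 1 has the height
  reached at \<open>j\<close>, and the prefix ending in n is one higher. Induction from the right
  end compares the remaining prefixes one by one.\<close>

lemma bal_insert_before: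
  assumes "distinct (u @ j # v)" and "\<forall>x\<in>set (u @ v). 1 < x \<and> x < n"
  shows "bal step (u @ 1 # n # j # v) \<longleftrightarrow> bal (into j step) (u @ j # v)"
  using assms
proof (induction v rule: rev_induct)
  case Nil
  have u: "bal (into j step) u = bal step u"
    using Nil by (intro bal_cong) (auto simp: into_def)
  have "bal step ((((u @ [1]) @ [n]) @ [j])) \<longleftrightarrow> bal step u \<and> 0 \<le> hgt step (u @ [1]) \<and>
      0 \<le> hgt step (u @ [1, n]) \<and> 0 \<le> hgt step (u @ [1, n, j])"
    by (simp only: bal_snoc) simp
  moreover have "hgt step (u @ [1, n]) = hgt step (u @ [1]) + 1"
    using hgt_snoc[of "u @ [1]" step n] j by (simp add: step_def)
  moreover have "hgt step (u @ [1, n, j]) = hgt step (u @ [1, n]) - 1"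
    using hgt_snoc[of "u @ [1, n]" step j] j by (simp add: step_def)
  ultimately show ?case
    using u hgt_insert_before[OF Nil] by (auto simp: bal_snoc)
next
  case (snoc x v)
  then have "bal step (u @ 1 # n # j # v) \<longleftrightarrow> bal (into j step) (u @ j # v)" by simp
  moreover have "bal step ((u @ 1 # n # j # v) @ [x]) \<longleftrightarrow>
      bal step (u @ 1 # n # j # v) \<and> 0 \<le> hgt step (u @ 1 # n # j # v @ [x])"
    by (subst bal_snoc) simp
  moreover have "bal (into j step) ((u @ j # v) @ [x]) \<longleftrightarrow>
      bal (into j step) (u @ j # v) \<and> 0 \<le> hgt (into j step) (u @ j # v @ [x])"
    by (subst bal_snoc) simp
  ultimately show ?case using hgt_insert_before[OF snoc.prems] by simp
qed

text \<open>The steps out of \<open>j\<close>, n and 1 add up to 1 - 1 + 1, the single forced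
  ascent; if \<open>v\<close> is empty the last one is missing and the total is 0.\<close>

lemma hgt_insert_after:
  assumes "distinct (u @ j # v)" and "\<forall>x\<in>set (u @ v). 1 < x \<and> x < n"
  shows "hgt step (u @ j # n # 1 # v) = hgt (out_of j step) (u @ j # v)"
proof -
  have "hgt step ((u @ [j]) @ n # 1 # v) = hgt step (u @ [j]) + 1 + hgt step (n # 1 # v)"
    using j by (subst hgt_append) (auto simp: step_def)
  moreover have "hgt step (n # 1 # v) = - 1 + (if v = [] then 0 else 1) + hgt step v"
  proof (cases "v = []")
    case False
    then have "hd v \<in> set (u @ v)" by simp
    then have "1 < hd v" using assms(2) by blast
    with False j show ?thesis by (simp add: hgt_Cons step_def)
  qed (use j in \<open>simp add: step_def\<close>)
  ultimately show ?thesis using hgt_out_of[OF assms(1), of step] by simp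
qed

text \<open>The extra prefixes, ending in n and in 1, have the height at \<open>j\<close> plus one
  and the height at \<open>j\<close>, so they impose nothing new.\<close>

lemma bal_insert_after:
  assumes "distinct (u @ j # v)" and "\<forall>x\<in>set (u @ v). 1 < x \<and> x < n"
  shows "bal step (u @ j # n # 1 # v) \<longleftrightarrow> bal (out_of j step) (u @ j # v)"
  using assms
proof (induction v rule: rev_induct)
  case Nil
  have uj: "hgt (out_of j step) (u @ [j]) = hgt step (u @ [j])"
    using hgt_out_of[OF Nil(1), of step] by simp
  have u: "bal (out_of j step) u = bal step u"
    using Nil by (intro bal_cong) (auto simp: out_of_def)
  have "bal step ((((u @ [j]) @ [n]) @ [1])) \<longleftrightarrow> bal step u \<and> 0 \<le> hgt step (u @ [j]) \<and>
      0 \<le> hgt step (u @ [j, n]) \<and> 0 \<le> hgt step (u @ [j, n, 1])"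
    by (simp only: bal_snoc) simp
  moreover have "hgt step (u @ [j, n]) = hgt step (u @ [j]) + 1"
    using hgt_snoc[of "u @ [j]" step n] j by (simp add: step_def)
  moreover have "hgt step (u @ [j, n, 1]) = hgt step (u @ [j, n]) - 1"
    using hgt_snoc[of "u @ [j, n]" step 1] j by (simp add: step_def)
  ultimately show ?case
    using u uj by (auto simp: bal_snoc)
next
  case (snoc x v)
  then have "bal step (u @ j # n # 1 # v) \<longleftrightarrow> bal (out_of j step) (u @ j # v)" by simp
  moreover have "bal step ((u @ j # n # 1 # v) @ [x]) \<longleftrightarrow>
      bal step (u @ j # n # 1 # v) \<and> 0 \<le> hgt step (u @ j # n # 1 # v @ [x])"
    by (subst bal_snoc) simp
  moreover have "bal (out_of j step) ((u @ j # v) @ [x]) \<longleftrightarrow>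
      bal (out_of j step) (u @ j # v) \<and> 0 \<le> hgt (out_of j step) (u @ j # v @ [x])"
    by (subst bal_snoc) simp
  ultimately show ?case using hgt_insert_after[OF snoc.prems] by simp
qed

text \<open>Deleting 1 and n leaves a word in which \<open>j\<close> marks the place of the factor,
  and the factor can be put back around \<open>j\<close>. The hypothesis on the multiset covers both
  orders of the factor at once.\<close>

lemma sum_words_with_factor:
  assumes m: "mset [a, b, c] = {#1, n, j#}"
    and f: "\<And>u v. distinct (u @ j # v) \<Longrightarrow> \<forall>x\<in>set (u @ v). 1 < x \<and> x < n \<Longrightarrow>
      f (u @ a # b # c # v) = g (u @ j # v)"
  shows "(\<Sum>w\<in>{w\<in>permutations_of_set {1..n}. sublist [a, b, c] w}. f w)
    = (\<Sum>w\<in>permutations_of_set {2..n - 1}. if j \<in> set w then g w else 0)"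
proof -
  define before where "before w = takeWhile (\<lambda>x. x \<noteq> j) w" for w
  define after where "after w = tl (dropWhile (\<lambda>x. x \<noteq> j) w)" for w
  have split: "before (u @ j # v) = u" "after (u @ j # v) = v" if "distinct (u @ j # v)" for u v
    using that by (auto simp: before_def after_def takeWhile_append dropWhile_append
        takeWhile_eq_all_conv dropWhile_eq_Nil_conv)
  let ?P = "permutations_of_set {2..n - 1}" and ?Q = "permutations_of_set {1..n}"
  let ?rem = "filter (\<lambda>x. x \<noteq> 1 \<and> x \<noteq> n)"
  have n: "{1..n} = insert 1 (insert n {2..n - 1})" "1 \<notin> {2..n - 1}" "n \<notin> {2..n - 1}" "1 \<noteq> n"
    using j by auto
  have abc: "filter (\<lambda>x. x \<noteq> 1 \<and> x \<noteq> n) [a, b, c] = [j]" "distinct [a, b, c]" "set [a, b, c] = {1, n, j}"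
  proof -
    have "mset (filter (\<lambda>x. x \<noteq> 1 \<and> x \<noteq> n) [a, b, c]) = {#j#}"
      unfolding mset_filter m using j by simp
    then show "filter (\<lambda>x. x \<noteq> 1 \<and> x \<noteq> n) [a, b, c] = [j]"
      by (metis mset_single_iff)
    show s: "set [a, b, c] = {1, n, j}"
      using arg_cong[OF m, of set_mset] by (simp only: set_mset_mset) simp
    have "card {1, n, j} = 3" using j by simp
    then show "distinct [a, b, c]" using s by (intro card_distinct) simp
  qed
  have "(\<Sum>w\<in>{w\<in>?Q. sublist [a, b, c] w}. f w) = (\<Sum>w\<in>{w\<in>?P. j \<in> set w}. g w)"
  proof (rule sum.reindex_bij_witness[of _ "\<lambda>w. before w @ a # b # c # after w" ?rem])
    fix w assume "w \<in> {w\<in>?Q. sublist [a, b, c] w}"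
    then obtain u v where w: "w = u @ a # b # c # v" and Q: "w \<in> ?Q"
      by (auto simp: sublist_def)
    have w': "w = u @ [a, b, c] @ v" by (simp add: w)
    have d: "distinct (u @ [a, b, c] @ v)" and s: "set u \<union> set [a, b, c] \<union> set v = {1..n}"
      using permutations_of_setD[OF Q] unfolding w' set_append Un_assoc by blast+
    have out: "x \<noteq> 1 \<and> x \<noteq> n \<and> x \<noteq> j" if "x \<in> set (u @ v)" for x
      using d that unfolding distinct_append set_append abc(3) by auto
    have "?rem (u @ [a, b, c] @ v) = ?rem u @ [j] @ ?rem v"
      by (simp only: filter_append abc(1))
    moreover have "?rem u = u" "?rem v = v"
      using out by (auto simp: filter_id_conv)
    ultimately have r: "?rem w = u @ j # v" unfolding w' by simp
    have dj: "distinct (u @ j # v)"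
      using d out by auto
    have "set (u @ j # v) = {2..n - 1}"
    proof -
      have "set (u @ j # v) = ({1..n} - {1, n, j}) \<union> {j}"
        unfolding s[symmetric] abc(3) using out by auto
      also have "\<dots> = {2..n - 1}" using j by auto
      finally show ?thesis .
    qed
    with dj r show "?rem w \<in> {w\<in>?P. j \<in> set w}"
      by (auto intro!: permutations_of_setI)
    show "before (?rem w) @ a # b # c # after (?rem w) = w"
      unfolding r split[OF dj] by (simp add: w)
    have "set (u @ v) \<subseteq> {2..n - 1}"
      using \<open>set (u @ j # v) = {2..n - 1}\<close> by auto
    moreover have "1 < x \<and> x < n" if "x \<in> {2..n - 1}" for x
      using that j by auto
    ultimately have "\<forall>x\<in>set (u @ v). 1 < x \<and> x < n" by blast
    then show "g (?rem w) = f w"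
      unfolding r using f[OF dj] by (simp add: w)
  next
    fix w assume wP: "w \<in> {w\<in>?P. j \<in> set w}"
    then obtain u v where w: "w = u @ j # v" by (auto dest: split_list)
    have d: "distinct (u @ j # v)" and s: "set (u @ j # v) = {2..n - 1}"
      using wP unfolding w by (blast dest: permutations_of_setD)+
    have eq: "before w @ a # b # c # after w = u @ [a, b, c] @ v"
      by (simp add: w split[OF d])
    have u: "x \<noteq> 1 \<and> x \<noteq> n" if "x \<in> set u \<union> set v" for x
    proof -
      have "x \<in> {2..n - 1}" using that unfolding s[symmetric] by auto
      then show ?thesis using j by auto
    qed
    have "?rem (u @ [a, b, c] @ v) = ?rem u @ [j] @ ?rem v"
      by (simp only: filter_append abc(1))
    moreover have "?rem u = u" "?rem v = v"
      using u by (auto simp: filter_id_conv)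
    ultimately show "?rem (before w @ a # b # c # after w) = w"
      unfolding eq by (simp add: w)
    have "distinct (u @ [a, b, c] @ v)"
      using d u abc(2) unfolding distinct_append set_append abc(3) by auto
    moreover have "set (u @ [a, b, c] @ v) = {1..n}"
      unfolding set_append abc(3) n(1) s[symmetric] by auto
    moreover have "sublist [a, b, c] (u @ [a, b, c] @ v)" by (rule sublist_appendI)
    ultimately show "before w @ a # b # c # after w \<in> {w\<in>?Q. sublist [a, b, c] w}"
      unfolding eq by (auto intro!: permutations_of_setI)
  qed
  also have "\<dots> = (\<Sum>w\<in>?P. if j \<in> set w then g w else 0)"
    by (intro sum.mono_neutral_cong_left) auto
  finally show ?thesis .
qed

lemma ballot_sum:
  assumes m: "mset [a, b, c] = {#1, n, j#}"
    and f: "\<And>u v. distinct (u @ j # v) \<Longrightarrow> \<forall>x\<in>set (u @ v). 1 < x \<and> x < n \<Longrightarrow>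
      bal_wt step (u @ a # b # c # v) = bal_wt c' (u @ j # v)"
  shows "(\<Sum>p\<in>{p. ballot n p \<and> sublist [a, b, c] (one_line n p)}. qpow (int n - 2 * int (des (one_line n p))))
    = value_at (wsum_at j (bal_wt c')) {2..n - 1}"
proof -
  let ?Q = "{p. p permutes {1..n}}"
  \<comment> \<open>A word with n letters has height \<open>n - 1 - 2 * des\<close>; the shift by
    one in \<open>bal_wt\<close> produces the exponent n - 2 des.\<close>
  have wt: "bal_wt step (one_line n p) = (if ballot n p then qpow (int n - 2 * int (des (one_line n p))) else 0)"
    if "p \<in> ?Q" for p
  proof -
    have "length (one_line n p) = n" by (simp add: one_line_def)
    moreover from this have "one_line n p \<noteq> []" using j by auto
    ultimately show ?thesis
      using that by (simp add: bal_wt_def ballot_iff_bal hgt_step_des)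
  qed
  have "(\<Sum>p\<in>{p. ballot n p \<and> sublist [a, b, c] (one_line n p)}. qpow (int n - 2 * int (des (one_line n p))))
    = (\<Sum>p\<in>?Q. if sublist [a, b, c] (one_line n p) then bal_wt step (one_line n p) else 0)"
    by (rule sum.mono_neutral_cong_left)
      (auto simp: finite_permutations ballot_def[of n] wt split: if_splits)
  also have "\<dots> = (\<Sum>w\<in>permutations_of_set {1..n}. if sublist [a, b, c] w then bal_wt step w else 0)"
    by (rule sum.reindex_bij_betw[OF bij_betw_one_line])
  also have "\<dots> = (\<Sum>w\<in>{w\<in>permutations_of_set {1..n}. sublist [a, b, c] w}. bal_wt step w)"
    by (intro sum.mono_neutral_cong_right) auto
  also have "\<dots> = value_at (wsum_at j (bal_wt c')) {2..n - 1}"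
    using sum_words_with_factor[OF m, of "bal_wt step" "bal_wt c'", OF f] by (simp add: wsum_at_def value_at_wsum)
  finally show ?thesis .
qed

lemma ballot_sum_before:
  "(\<Sum>p\<in>{p. ballot n p \<and> sublist [1, n, j] (one_line n p)}. qpow (int n - 2 * int (des (one_line n p))))
    = value_at (wsum_at j (bal_wt (into j step))) {2..n - 1}"
proof (rule ballot_sum)
  show "mset [1, n, j] = {#1, n, j#}" by (simp)
  fix u v assume "distinct (u @ j # v)" "\<forall>x\<in>set (u @ v). 1 < x \<and> x < n"
  then show "bal_wt step (u @ 1 # n # j # v) = bal_wt (into j step) (u @ j # v)"
    unfolding bal_wt_def using hgt_insert_before[of u v] bal_insert_before[of u v] by simp
qed

lemma ballot_sum_after:
  "(\<Sum>p\<in>{p. ballot n p \<and> sublist [j, n, 1] (one_line n p)}. qpow (int n - 2 * int (des (one_line n p))))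
    = value_at (wsum_at j (bal_wt (out_of j step))) {2..n - 1}"
proof (rule ballot_sum)
  show "mset [j, n, 1] = {#1, n, j#}" by (simp add: add_mset_commute)
  fix u v assume "distinct (u @ j # v)" "\<forall>x\<in>set (u @ v). 1 < x \<and> x < n"
  then show "bal_wt step (u @ j # n # 1 # v) = bal_wt (out_of j step) (u @ j # v)"
    unfolding bal_wt_def using hgt_insert_after[of u v] bal_insert_after[of u v] by simp
qed

section \<open>Odd cycles containing the factor 1 n j\<close>

lemma cycle_words_with_factor:
  assumes A: "A \<subseteq> {2..n - 1}"
  shows "(\<Sum>v\<in>permutations_of_set (insert 1 (insert n A)).
      if hd v = 1 \<and> odd (length v) \<and> take 3 v = [1, n, j] then qpow \<bar>hgt step v - 1\<bar> else 0)
    = (\<Sum>w\<in>permutations_of_set A. if hd w = j \<and> odd (length w) then qpow (1 * \<bar>hgt step w - 1\<bar>) else 0)"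
proof -
  let ?P = "\<lambda>v. hd v = 1 \<and> odd (length v) \<and> take 3 v = [1, n, j]"
  have nA: "1 \<notin> A" "n \<notin> A" using A j by auto
  have "(\<Sum>v\<in>permutations_of_set (insert 1 (insert n A)). if ?P v then qpow \<bar>hgt step v - 1\<bar> else 0)
    = (\<Sum>v\<in>{v\<in>permutations_of_set (insert 1 (insert n A)). ?P v}. qpow \<bar>hgt step v - 1\<bar>)"
    by (intro sum.mono_neutral_cong_right) auto
  also have "\<dots> = (\<Sum>w\<in>{w\<in>permutations_of_set A. hd w = j \<and> odd (length w)}. qpow (1 * \<bar>hgt step w - 1\<bar>))"
  proof (rule sum.reindex_bij_witness[of _ "\<lambda>w. 1 # n # w" "drop 2"])
    fix v assume v: "v \<in> {v\<in>permutations_of_set (insert 1 (insert n A)). ?P v}"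
    have "v = take 3 v @ drop 3 v" by simp
    with v have eq: "v = 1 # n # j # drop 3 v" by simp
    then obtain w where w: "v = 1 # n # j # w" by blast
    have "distinct v" "set v = insert 1 (insert n A)"
      using v by (auto dest: permutations_of_setD)
    then have "distinct (j # w)" "set (j # w) = A"
      using nA by (auto simp: w insert_eq_iff)
    then have "j # w \<in> permutations_of_set A" by (intro permutations_of_setI)
    with v show "drop 2 v \<in> {w\<in>permutations_of_set A. hd w = j \<and> odd (length w)}"
      by (simp add: w)
    show "1 # n # drop 2 v = v" by (simp add: w)
    \<comment> \<open>The steps from 1 to n and from n to \<open>j\<close> cancel, so the shorter
      word has the same height. Its closing step is counted as a descent in both words: the genuine
      one into 1, the formal one into \<open>j\<close>.\<close>
    show "qpow (1 * \<bar>hgt step (drop 2 v) - 1\<bar>) = qpow \<bar>hgt step v - 1\<bar>"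
      using j by (simp add: w step_def)
  next
    fix w assume w: "w \<in> {w\<in>permutations_of_set A. hd w = j \<and> odd (length w)}"
    then obtain w' where w': "w = j # w'" by (cases w) auto
    have "distinct w" "set w = A" using w by (auto dest: permutations_of_setD)
    then have "distinct (1 # n # w)" "set (1 # n # w) = insert 1 (insert n A)"
      using nA j by auto
    then have "1 # n # w \<in> permutations_of_set (insert 1 (insert n A))"
      by (intro permutations_of_setI)
    moreover have "?P (1 # n # w)" using w by (simp add: w')
    ultimately show "1 # n # w \<in> {v\<in>permutations_of_set (insert 1 (insert n A)). ?P v}"
      by blast
    show "drop 2 (1 # n # w) = w" by simp
  qed
  also have "\<dots> = (\<Sum>w\<in>permutations_of_set A. if hd w = j \<and> odd (length w) then qpow (1 * \<bar>hgt step w - 1\<bar>) else 0)"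
    by (intro sum.mono_neutral_cong_left) auto
  finally show ?thesis .
qed

lemma support_take_3_iff:
  assumes q: "q permutes {1..n}"
  shows "take 3 (support q 1) = [1, n, j] \<longleftrightarrow> q 1 = n \<and> q n = j"
proof -
  have "permutation q" using q by (auto simp: permutation_permutes)
  note l = least_power_of_permutation[OF this, of 1]
  have nth: "take 3 (support q 1) ! i = (q ^^ i) 1" if "i < 3" "i < least_power q 1" for i
    using that by simp
  show ?thesis
  proof
    assume eq: "take 3 (support q 1) = [1, n, j]"
    then have "length (take 3 (support q 1)) = 3" by (simp only:) simp
    then have "2 < least_power q 1" by simp
    then show "q 1 = n \<and> q n = j"
      using nth[of 1] nth[of 2] unfolding eq by (simp add: numeral_2_eq_2)
  next
    assume eq: "q 1 = n \<and> q n = j"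
    \<comment> \<open>An orbit of length 1 would give n = 1 and one of length 2 would give j =
      1.\<close>
    have "least_power q 1 \<noteq> 1" "least_power q 1 \<noteq> 2" "least_power q 1 \<noteq> 0"
      using l eq j by (auto simp: numeral_2_eq_2)
    then have len: "2 < least_power q 1" by linarith
    show "take 3 (support q 1) = [1, n, j]"
    proof (rule nth_equalityI)
      show "length (take 3 (support q 1)) = length [1, n, j]" using len by simp
      fix i assume "i < length (take 3 (support q 1))"
      then have i: "i < 3" "i < least_power q 1" by auto
      then consider "i = 0" | "i = 1" | "i = 2" by linarith
      then show "take 3 (support q 1) ! i = [1, n, j] ! i"
        unfolding nth[OF i] by cases (use eq in \<open>simp_all add: numeral_2_eq_2\<close>)
    qed
  qed
qed

text \<open>Only cycles whose letter set contains 1 and n contribute. Deleting these two letters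
  turns the sum over the cycle through 1 into a sum over words starting with \<open>j\<close> on
  subsets of \<open>{2..n - 1}\<close>, while the complement, and with it the sum over the other
  cycles, stays the same.\<close>

lemma odd_perm_sum_with_factor:
  "(\<Sum>q\<in>{q\<in>odd_perms {1..n}. q 1 = n \<and> q n = j}. qpow (int n - 2 * int (cyc_stat {1..n} q)))
    = value_at (odd_cycle_sum j step 1 * wsum (bal_wt step)) {2..n - 1}"
proof -
  let ?S = "{1..n}" and ?S' = "{2..n - 1}"
  let ?\<phi> = "\<lambda>v. if hd v = 1 \<and> odd (length v) \<and> take 3 v = [1, n, j] then qpow \<bar>hgt step v - 1\<bar> else 0"
  have S: "?S = insert 1 (insert n ?S')" "1 \<notin> ?S'" "n \<notin> ?S'" using j by auto
  have k: "1 \<in> ?S" "1 = Min ?S" using j by (auto intro!: Min_eqI[symmetric])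
  have "{q\<in>odd_perms ?S. q 1 = n \<and> q n = j} = {q\<in>odd_perms ?S. take 3 (support q 1) = [1, n, j]}"
    using support_take_3_iff by (auto simp: odd_perms_def)
  then have "(\<Sum>q\<in>{q\<in>odd_perms ?S. q 1 = n \<and> q n = j}. qpow (int n - 2 * int (cyc_stat ?S q)))
    = (\<Sum>A\<in>Pow ?S. (\<Sum>v\<in>permutations_of_set A. ?\<phi> v) * odd_perm_sum (?S - A))"
    using odd_perm_sum_by_cycle[OF _ k, of "\<lambda>v. take 3 v = [1, n, j]"] by simp
  also have "\<dots> = (\<Sum>A\<in>(\<lambda>A. insert 1 (insert n A)) ` Pow ?S'.
      (\<Sum>v\<in>permutations_of_set A. ?\<phi> v) * odd_perm_sum (?S - A))"
  proof (rule sum.mono_neutral_right)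
    show "(\<lambda>A. insert 1 (insert n A)) ` Pow ?S' \<subseteq> Pow ?S" unfolding S(1) by auto
    show "\<forall>A\<in>Pow ?S - (\<lambda>A. insert 1 (insert n A)) ` Pow ?S'.
      (\<Sum>v\<in>permutations_of_set A. ?\<phi> v) * odd_perm_sum (?S - A) = 0"
    proof
      fix A assume A: "A \<in> Pow ?S - (\<lambda>A. insert 1 (insert n A)) ` Pow ?S'"
      have "\<not> (1 \<in> A \<and> n \<in> A)"
      proof
        assume "1 \<in> A \<and> n \<in> A"
        then have "A = insert 1 (insert n (A - {1, n}))" by auto
        moreover have "A - {1, n} \<in> Pow ?S'" using A unfolding S(1) by auto
        ultimately show False using A by blast
      qed
      have "take 3 v \<noteq> [1, n, j]" if "v \<in> permutations_of_set A" for v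
      proof
        assume "take 3 v = [1, n, j]"
        then have "set [1, n, j] \<subseteq> set v" by (metis set_take_subset)
        with that \<open>\<not> (1 \<in> A \<and> n \<in> A)\<close> show False by (simp add: permutations_of_setD)
      qed
      then show "(\<Sum>v\<in>permutations_of_set A. ?\<phi> v) * odd_perm_sum (?S - A) = 0" by simp
    qed
  qed simp
  also have "\<dots> = (\<Sum>A\<in>Pow ?S'. (\<Sum>v\<in>permutations_of_set (insert 1 (insert n A)). ?\<phi> v) *
      odd_perm_sum (?S - insert 1 (insert n A)))"
  proof (rule sum.reindex_cong[OF _ refl refl])
    show "inj_on (\<lambda>A. insert 1 (insert n A)) (Pow ?S')"
    proof (rule inj_onI)
      fix A B assume AB: "A \<in> Pow ?S'" "B \<in> Pow ?S'" and eq: "insert 1 (insert n A) = insert 1 (insert n B)"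
      have "1 \<notin> A" "n \<notin> A" "1 \<notin> B" "n \<notin> B"
        using S(2,3) AB by blast+
      then have "A = insert 1 (insert n A) - {1, n}" "B = insert 1 (insert n B) - {1, n}"
        by blast+
      then show "A = B" using eq by metis
    qed
  qed
  also have "\<dots> = value_at (odd_cycle_sum j step 1 * wsum (bal_wt step)) ?S'"
    unfolding value_at_mult
  proof (intro sum.cong refl)
    fix A assume A: "A \<in> Pow ?S'"
    have "?S - insert 1 (insert n A) = ?S' - A" unfolding S(1) using S by auto
    then have "odd_perm_sum (?S - insert 1 (insert n A)) = value_at (wsum (bal_wt step)) (?S' - A)"
      by (simp add: odd_perm_sum_eq_bal_sum)
    then show "(\<Sum>v\<in>permutations_of_set (insert 1 (insert n A)). ?\<phi> v) *
        odd_perm_sum (?S - insert 1 (insert n A))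
      = value_at (odd_cycle_sum j step 1) A * value_at (wsum (bal_wt step)) (?S' - A)"
      using cycle_words_with_factor[of A] A by (simp only: odd_cycle_sum_def value_at_wsum Pow_iff)
  qed
  finally show ?thesis .
qed

end

section \<open>Back to the two counting functions\<close>

lemma cycle_word_iff: "cycle_word n p v \<longleftrightarrow> cyc_word {1..n} p v"
proof (cases "v = []")
  case False
  have "(\<forall>i<length v. p (v ! i) = v ! (Suc i mod length v)) \<longleftrightarrow> map p v = rotate1 v"
    by (auto simp: list_eq_iff_nth_eq nth_rotate1)
  then show ?thesis by (simp add: cycle_word_def cyc_word_def)
qed (simp add: cycle_word_def cyc_word_def)

lemma cycles_of_eq: "cycles_of n p = cycs {1..n} p"
  by (simp add: cycles_of_def cycs_def cycle_word_iff)

lemma odd_order_iff: "odd_order n p \<longleftrightarrow> p \<in> odd_perms {1..n}"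
  by (simp add: odd_order_def odd_perms_def cycles_of_eq)

lemma M_stat_eq: "M_stat n p = cyc_stat {1..n} p"
  by (simp add: M_stat_def cyc_stat_def cycles_of_eq)

text \<open>Inside a cycle word consecutive letters are successive images, and a factor never wraps
  around. Conversely, the cycle read from 1 begins with the factor.\<close>

lemma cyclic_factor_iff:
  assumes p: "p permutes {1..n}" and j: "1 < j" "j < n"
  shows "cyclic_factor n [1, n, j] p \<longleftrightarrow> p 1 = n \<and> p n = j"
proof
  assume "cyclic_factor n [1, n, j] p"
  then obtain u v where w: "cycle_word n p (u @ [1, n, j] @ v)"
    by (auto simp: cyclic_factor_def sublist_def)
  let ?w = "u @ [1, n, j] @ v"
  have succ: "p (?w ! i) = ?w ! Suc i" if "Suc i < length ?w" for i
  proof -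
    have "p (?w ! i) = ?w ! (Suc i mod length ?w)"
      using w that unfolding cycle_word_def by (metis Suc_lessD)
    then show ?thesis by (simp only: mod_less[OF that])
  qed
  have "?w ! length u = 1" "?w ! Suc (length u) = n" "?w ! Suc (Suc (length u)) = j"
    by (simp_all add: nth_append)
  with succ[of "length u"] succ[of "Suc (length u)"] show "p 1 = n \<and> p n = j"
    by simp
next
  assume "p 1 = n \<and> p n = j"
  then have t: "take 3 (support p 1) = [1, n, j]" using support_take_3_iff[OF j p] by simp
  have "1 \<in> {1..n}" "1 = Min {1..n}" using j by (auto intro!: Min_eqI[symmetric])
  then have "cycle_word n p (support p 1)"
    using cyc_word_support(1)[OF _ _ _ p] by (simp add: cycle_word_iff)
  moreover have "sublist [1, n, j] (support p 1)"
    unfolding t[symmetric] by (rule sublist_take)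
  ultimately show "cyclic_factor n [1, n, j] p" unfolding cyclic_factor_def by blast
qed

text \<open>The exponent \<open>a - 2 * f x\<close> determines \<open>f x\<close>, so a coefficient
  counts one fibre of the statistic.\<close>

lemma lookup_sum_qpow:
  "finite X \<Longrightarrow> Poly_Mapping.lookup (\<Sum>x\<in>X. qpow (a - 2 * int (f x))) (a - 2 * int d) = int (card {x\<in>X. f x = d})"
  by (auto simp: lookup_sum qpow_def lookup_single when_def sum.If_cases Int_def intro!: arg_cong[of _ _ card])

theorem theorem1p4:
  fixes n d j :: nat
  assumes "n \<ge> 3" and "2 \<le> j" and "j \<le> n - 1"
  shows "ballot_count n d 1 j + ballot_count n d j 1 = 2 * odd_count n d 1 j"
proof -
  have j: "1 < j" "j < n" using assms by auto
  let ?e = "int n - 2 * int d" and ?S = "{2..n - 1}"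
  let ?lookup = "\<lambda>f. Poly_Mapping.lookup (value_at f ?S) ?e"
  have fin: "finite {p. p permutes {1..n}}" by (simp add: finite_permutations)
  have ballot: "int (ballot_count n d a b) = Poly_Mapping.lookup
      (\<Sum>p\<in>{p. ballot n p \<and> sublist [a, n, b] (one_line n p)}. qpow (int n - 2 * int (des (one_line n p)))) ?e"
    for a b
    by (subst lookup_sum_qpow)
      (auto simp: ballot_count_def ballot_def intro!: arg_cong[of _ _ card] finite_subset[OF _ fin])
  let ?Q = "{q\<in>odd_perms {1..n}. q 1 = n \<and> q n = j}"
  have "cyclic_factor n [1, n, j] q \<longleftrightarrow> q 1 = n \<and> q n = j" if "q \<in> odd_perms {1..n}" for q
    using that by (intro cyclic_factor_iff[OF _ j]) (simp add: odd_perms_def)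
  then have "odd_count n d 1 j = card {q\<in>?Q. cyc_stat {1..n} q = d}"
    unfolding odd_count_def odd_order_iff M_stat_eq by (intro arg_cong[of _ _ card]) blast
  moreover have "finite ?Q" by (rule finite_subset[OF _ fin]) (auto simp: odd_perms_def)
  ultimately have "int (odd_count n d 1 j) = Poly_Mapping.lookup
      (\<Sum>q\<in>?Q. qpow (int n - 2 * int (cyc_stat {1..n} q))) ?e"
    by (simp only: lookup_sum_qpow)
  also have "\<dots> = ?lookup (odd_cycle_sum j step 1 * wsum (bal_wt step))"
    by (simp only: odd_perm_sum_with_factor[OF j])
  finally have odd: "int (odd_count n d 1 j) = ?lookup (odd_cycle_sum j step 1 * wsum (bal_wt step))" .
  have "int (ballot_count n d 1 j + ballot_count n d j 1)
    = ?lookup (wsum_at j (bal_wt (into j step)) + wsum_at j (bal_wt (out_of j step)))"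
    by (simp only: of_nat_add ballot ballot_sum_before[OF j] ballot_sum_after[OF j] value_at_add lookup_add)
  \<comment> \<open>Here \<open>j\<close> is the marked letter inside \<open>{2..n - 1}\<close> and
    need not be its minimum, unlike in the recursion for odd order permutations.\<close>
  also have "\<dots> = ?lookup (const 2 * (odd_cycle_sum j step 1 * wsum (bal_wt step)))"
    by (simp only: marked_bal_sum[OF unit_step_step antisym_step_step] mult.assoc)
  also have "\<dots> = 2 * ?lookup (odd_cycle_sum j step 1 * wsum (bal_wt step))"
    by (simp only: value_at_const_mult mult_2 lookup_add)
  finally show ?thesis using odd by linarith
qed

end
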